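(* Let $F$ be a regular flow on $\mathbb{R}^2$. Then $\Lambda^2_F(p)=\bigcup_{k\ge 1}\Lambda^{1,k}_F(p)$ and $\Lambda^\star_F(p)=\Lambda^2_F(p)$ for all $p\in\mathbb{R}^2$. In particular, $\operatorname{rank}(F)\leq 2$.
   Context: A flow on $X=\mathbb{R}^2$ is a continuous map $F:\mathbb{R}\times X\to X$, $(t,x)\mapsto F^t(x)$, with $F^t(F^s(x))=F^{t+s}(x)$ and $F^0(x)=x$. The orbit of $q$ is $\mathcal{O}_F(q)=\{F^t(q):t\in\mathbb{R}\}$. Let $d$ be a distance on $X$ compatible with its topology. Regular flow: $F$ is regular if it is locally topologically equivalent to the flow $G$ of a constant nonzero vector field, i.e. for every $p$ there are an open neighborhood $U_p$ of $p$ and a homeomorphism $\phi_p:U_p\to\mathbb{R}^2$ such that $\phi_p(\mathcal{O}_F(q)\cap U_p)=\mathcal{O}_G(\phi_p(q))$ for every $q\in U_p$. First prolongational limit set: $\Lambda^1_F(p)$ is the set of all $q$ such that for every $\varepsilon>0$ and $T>0$ there are $x\in X$ and $\tau\ge T$ with $d(p,x)<\varepsilon$ and $d(q,F^\tau(x))<\varepsilon$. For an ordinal $\beta\ge1$ and $A\subset X$, put $\Lambda^\beta_F(A)=\bigcup_{x\in A}\Lambda^\beta_F(x)$, $\Lambda^{\beta,1}_F(p)=\Lambda^\beta_F(p)$ and $\Lambda^{\beta,k+1}_F(p)=\Lambda^\beta_F(\Lambda^{\beta,k}_F(p))$ for integers $k\geq1$. Higher prolongational limit sets are defined by transfinite induction.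 If $\alpha\ge2$ is a successor ordinal, $\Lambda^\alpha_F(p)$ is the set of all $q$ for which there are sequences $p_n\to p$, $q_n\to q$ in $X$ and integers $k_n\ge1$ with $q_n\in\Lambda^{\alpha-1,k_n}_F(p_n)$ for all $n$. If $\alpha$ is a limit ordinal, $\Lambda^\alpha_F(p)$ is the set of all $q$ for which there are sequences $p_n\to p$, $q_n\to q$, integers $k_n\ge1$ and ordinals $1\le\beta_n<\alpha$ with $q_n\in\Lambda^{\beta_n,k_n}_F(p_n)$ for all $n$. The sets $\Lambda^\alpha_F(p)$ increase with $\alpha$; $\Lambda^\star_F(p)$ denotes the largest of them (their union over all ordinals $\alpha\geq 1$). The rank of $F$ is the smallest ordinal $\alpha$ such that $\Lambda^\star_F(p)=\Lambda^\alpha_F(p)$ for every $p\in X$ (with the convention $\Lambda^0_F(p)=\emptyset$, so rank is $0$ when all $\Lambda^\star_F(p)$ are empty). *)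

theory Defs
  imports "HOL-Analysis.Analysis"
begin

type_synonym plane = "real ^ 2"

section \<open>Flows\<close>

definition flow :: "(real \<Rightarrow> 'a::topological_space \<Rightarrow> 'a) \<Rightarrow> bool" where
  "flow F \<longleftrightarrow>
     continuous_on UNIV (\<lambda>(t, x). F t x) \<and>
     (\<forall>s t x. F t (F s x) = F (t + s) x) \<and>
     (\<forall>x. F 0 x = x)"

definition orbit :: "(real \<Rightarrow> 'a \<Rightarrow> 'a) \<Rightarrow> 'a \<Rightarrow> 'a set" where
  "orbit F q = range (\<lambda>t. F t q)"

definition constant_flow :: "plane \<Rightarrow> real \<Rightarrow> plane \<Rightarrow> plane" where
  "constant_flow v t x = x + t *\<^sub>R v"

definition regular_flow :: "(real \<Rightarrow> plane \<Rightarrow> plane) \<Rightarrow> bool" where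
  "regular_flow F \<longleftrightarrow> flow F \<and>
     (\<exists>v. v \<noteq> 0 \<and>
       (\<forall>p. \<exists>U \<phi> \<psi>. open U \<and> p \<in> U \<and> homeomorphism U UNIV \<phi> \<psi> \<and>
         (\<forall>q\<in>U. \<phi> ` (orbit F q \<inter> U) = orbit (constant_flow v) (\<phi> q))))"

definition compatible_distance :: "('a::topological_space \<Rightarrow> 'a \<Rightarrow> real) \<Rightarrow> bool" where
  "compatible_distance d \<longleftrightarrow>
     Metric_space UNIV d \<and> Metric_space.mtopology UNIV d = euclidean"

section \<open>Ordinals\<close>

text \<open>Elements of a well-ordered type are read as ordinals: an element stands for the order
  type of the set of its predecessors. The successor is meaningful for non-maximal elements.\<close>

definition ord_zero :: "'o::wellorder" where
  "ord_zero = (LEAST a. True)"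

definition ord_suc :: "'o::wellorder \<Rightarrow> 'o" where
  "ord_suc a = (LEAST b. a < b)"

definition ord_nat :: "nat \<Rightarrow> 'o::wellorder" where
  "ord_nat n = (ord_suc ^^ n) ord_zero"

lemma ord_zero_le [simp]: "ord_zero \<le> (a :: 'o::wellorder)"
  unfolding ord_zero_def by (rule Least_le) simp

lemma ord_suc_greater: "a < b \<Longrightarrow> a < ord_suc (a :: 'o::wellorder)"
  unfolding ord_suc_def by (rule LeastI)

lemma ord_suc_le: "a < b \<Longrightarrow> ord_suc a \<le> (b :: 'o::wellorder)"
  unfolding ord_suc_def by (rule Least_le)

lemma ord_suc_inject:
  fixes a b c :: "'o::wellorder"
  assumes "a < c" "b < c" "ord_suc a = c" "ord_suc b = c"
  shows "a = b"
  using assms by (metis leD linorder_cases ord_suc_le)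

text \<open>The type of all ordinals below the successor cardinal of the continuum. An increasing
  family of subsets of \<open>plane \<times> plane\<close> indexed by it stabilises, so that it can replace the
  class of all ordinals; see \<open>prolong_subset_prolong_star\<close> below.\<close>

abbreviation ordinal_rel :: "(plane \<times> plane) set rel" where
  "ordinal_rel \<equiv> cardSuc (card_of (UNIV :: (plane \<times> plane) set))"

lemma infinite_Field_ordinal_rel: "infinite (Field ordinal_rel)"
proof -
  have "infinite (UNIV :: real set)"
    by (rule infinite_UNIV_char_0)
  moreover have "inj (vec :: real \<Rightarrow> plane)"
    by (auto simp: inj_on_def vec_eq_iff)
  ultimately have "infinite (UNIV :: plane set)"
    using finite_imageD[of "vec :: real \<Rightarrow> plane" UNIV] finite_subset[OF subset_UNIV] by blast
  then have "infinite (UNIV :: (plane \<times> plane) set)"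
    by (simp add: finite_prod)
  then show ?thesis
    by (simp only: cardSuc_finite[OF card_of_Card_order] Field_card_of) simp
qed

typedef ordinal = "Field ordinal_rel"
  using infinite_Field_ordinal_rel by (metis ex_in_conv finite.emptyI)

instantiation ordinal :: wellorder
begin

definition less_eq_ordinal :: "ordinal \<Rightarrow> ordinal \<Rightarrow> bool" where
  "a \<le> b \<longleftrightarrow> (Rep_ordinal a, Rep_ordinal b) \<in> ordinal_rel"

definition less_ordinal :: "ordinal \<Rightarrow> ordinal \<Rightarrow> bool" where
  "(a::ordinal) < b \<longleftrightarrow> a \<le> b \<and> \<not> b \<le> a"

instance
proof
  have wo: "Well_order ordinal_rel"
    by (simp add: cardSuc_Well_order card_of_Card_order)
  then have r: "refl_on (Field ordinal_rel) ordinal_rel" and t: "trans ordinal_rel"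
    and as: "antisym ordinal_rel" and tot: "total_on (Field ordinal_rel) ordinal_rel"
    and w: "wf (ordinal_rel - Id)"
    by (auto simp: well_order_on_def linear_order_on_def partial_order_on_def preorder_on_def)
  fix a b c :: ordinal
  show "a < b \<longleftrightarrow> a \<le> b \<and> \<not> b \<le> a"
    by (rule less_ordinal_def)
  show "a \<le> a"
    using r Rep_ordinal by (auto simp: less_eq_ordinal_def refl_on_def)
  show "a \<le> c" if "a \<le> b" "b \<le> c"
    using t that by (auto simp: less_eq_ordinal_def elim: transE)
  show "a = b" if "a \<le> b" "b \<le> a"
    using antisymD[OF as] that by (simp add: less_eq_ordinal_def flip: Rep_ordinal_inject)
  show "a \<le> b \<or> b \<le> a"
    using tot r Rep_ordinal[of a] Rep_ordinal[of b]
    by (cases "a = b") (auto simp: less_eq_ordinal_def total_on_def refl_on_def Rep_ordinal_inject)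
  fix P :: "ordinal \<Rightarrow> bool" and a :: ordinal
  assume step: "\<And>x. (\<And>y. y < x \<Longrightarrow> P y) \<Longrightarrow> P x"
  have "wf (inv_image (ordinal_rel - Id) Rep_ordinal)"
    using w by (rule wf_inv_image)
  then show "P a"
  proof (induction a rule: wf_induct_rule)
    case (less x)
    show ?case
    proof (rule step)
      fix y assume "y < x"
      then have "(y, x) \<in> inv_image (ordinal_rel - Id) Rep_ordinal"
        by (auto simp: less_ordinal_def less_eq_ordinal_def Rep_ordinal_inject)
      then show "P y" by (rule less)
    qed
  qed
qed

end

lemma ordinal_no_max: "\<exists>b. a < (b :: ordinal)"
proof -
  have "Card_order ordinal_rel"
    by (simp add: cardSuc_Card_order card_of_Card_order)
  then obtain b where b: "b \<in> Field ordinal_rel" "Rep_ordinal a \<noteq> b" "(Rep_ordinal a, b) \<in> ordinal_rel"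
    using infinite_Card_order_limit[OF _ infinite_Field_ordinal_rel Rep_ordinal] by blast
  have "a \<le> Abs_ordinal b" "a \<noteq> Abs_ordinal b"
    using b by (auto simp: less_eq_ordinal_def Abs_ordinal_inverse)
  then show ?thesis by (auto simp: order.strict_iff_order)
qed

lemma ordinal_less_suc: "(a :: ordinal) < ord_suc a"
  using ordinal_no_max ord_suc_greater by blast

lemma not_inj_ordinal:
  includes cardinal_syntax
  fixes f :: "ordinal \<Rightarrow> plane \<times> plane"
  shows "\<not> inj f"
proof
  assume f: "inj f"
  let ?c = "card_of (UNIV :: (plane \<times> plane) set)"
  have "inj_on (f \<circ> Abs_ordinal) (Field ordinal_rel)"
    using f by (intro comp_inj_on inj_on_subset[OF f]) (auto intro: inj_onI dest: Abs_ordinal_inject[THEN iffD1, rotated 2])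
  then have "card_of (Field ordinal_rel) \<le>o ?c"
    unfolding card_of_ordLeq[symmetric] by blast
  moreover have "ordinal_rel =o card_of (Field ordinal_rel)"
    by (simp add: card_of_Field_ordIso cardSuc_Card_order card_of_Card_order ordIso_symmetric)
  ultimately have "ordinal_rel \<le>o ?c"
    by (rule ordIso_ordLeq_trans[rotated])
  then show False
    using cardSuc_greater[OF card_of_Card_order] not_ordLess_ordLeq by blast
qed

section \<open>Prolongational limit sets\<close>

definition prolong1 ::
  "('a \<Rightarrow> 'a \<Rightarrow> real) \<Rightarrow> (real \<Rightarrow> 'a \<Rightarrow> 'a) \<Rightarrow> 'a \<Rightarrow> 'a set" where
  "prolong1 d F p =
     {q. \<forall>\<epsilon>>0. \<forall>T>0. \<exists>x \<tau>. \<tau> \<ge> T \<and> d p x < \<epsilon> \<and> d q (F \<tau> x) < \<epsilon>}"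

text \<open>For \<open>k \<ge> 1\<close> this is the set with exponents \<open>\<beta>,k\<close> if \<open>R\<close> is the set-valued map with
  exponent \<open>\<beta>\<close>; in particular \<open>iterate R 1 = R\<close>.\<close>

definition iterate :: "('a \<Rightarrow> 'a set) \<Rightarrow> nat \<Rightarrow> 'a \<Rightarrow> 'a set" where
  "iterate R k p = ((\<lambda>A. \<Union>x\<in>A. R x) ^^ k) {p}"

text \<open>The maps \<open>R n\<close> are taken from the family \<open>S\<close> of previously constructed maps: a singleton
  at successor ordinals, all maps with smaller nonzero index at limit ordinals.\<close>

definition prolong_step :: "('a::topological_space \<Rightarrow> 'a set) set \<Rightarrow> 'a \<Rightarrow> 'a set" where
  "prolong_step S p =
     {q. \<exists>P Q k R. P \<longlonglongrightarrow> p \<and> Q \<longlonglongrightarrow> q \<and>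
        (\<forall>n. k n \<ge> 1 \<and> R n \<in> S \<and> Q n \<in> iterate (R n) (k n) (P n))}"

function prolong ::
  "('a::topological_space \<Rightarrow> 'a \<Rightarrow> real) \<Rightarrow> (real \<Rightarrow> 'a \<Rightarrow> 'a) \<Rightarrow> 'o::wellorder \<Rightarrow> 'a \<Rightarrow> 'a set"
  where
  "prolong d F \<alpha> =
     (if \<alpha> = ord_zero then (\<lambda>p. {})
      else if \<alpha> = ord_suc ord_zero then prolong1 d F
      else if \<exists>\<beta><\<alpha>. \<alpha> = ord_suc \<beta>
        then prolong_step {prolong d F (THE \<beta>. \<beta> < \<alpha> \<and> \<alpha> = ord_suc \<beta>)}
      else prolong_step (prolong d F ` {\<beta>. ord_suc ord_zero \<le> \<beta> \<and> \<beta> < \<alpha>}))"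
  by pat_completeness auto
termination
proof (relation "inv_image {(x, y). x < y} (\<lambda>(d, F, \<alpha>). \<alpha>)", goal_cases)
  case 1
  show ?case by (intro wf_inv_image wf)
next
  case (2 d F \<alpha>)
  then obtain \<beta> where "\<beta> < \<alpha>" "\<alpha> = ord_suc \<beta>" by blast
  then have "(THE \<beta>. \<beta> < \<alpha> \<and> \<alpha> = ord_suc \<beta>) = \<beta>"
    by (intro the_equality) (auto intro: ord_suc_inject)
  with \<open>\<beta> < \<alpha>\<close> show ?case by simp
qed auto

declare prolong.simps [simp del]

definition prolong_star ::
  "(plane \<Rightarrow> plane \<Rightarrow> real) \<Rightarrow> (real \<Rightarrow> plane \<Rightarrow> plane) \<Rightarrow> plane \<Rightarrow> plane set" where
  "prolong_star d F p = (\<Union>\<alpha>\<in>{\<alpha>::ordinal. ord_nat 1 \<le> \<alpha>}. prolong d F \<alpha> p)"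

definition flow_rank ::
  "(plane \<Rightarrow> plane \<Rightarrow> real) \<Rightarrow> (real \<Rightarrow> plane \<Rightarrow> plane) \<Rightarrow> ordinal" where
  "flow_rank d F = (LEAST \<alpha>. \<forall>p. prolong_star d F p = prolong d F \<alpha> p)"

lemma prolong_zero: "prolong d F ord_zero = (\<lambda>p. {})"
  by (simp add: prolong.simps)

lemma prolong_one: "ord_suc ord_zero \<noteq> (ord_zero :: 'o::wellorder) \<Longrightarrow>
    prolong d F (ord_suc ord_zero :: 'o) = prolong1 d F"
  by (subst prolong.simps) simp

lemma prolong_suc:
  fixes \<beta> :: "'o::wellorder"
  assumes "ord_zero < \<beta>" "\<beta> < ord_suc \<beta>"
  shows "prolong d F (ord_suc \<beta>) = prolong_step {prolong d F \<beta>}"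
proof -
  have "(THE \<gamma>. \<gamma> < ord_suc \<beta> \<and> ord_suc \<beta> = ord_suc \<gamma>) = \<beta>"
    using assms by (intro the_equality) (auto intro: ord_suc_inject)
  moreover have "ord_suc \<beta> \<noteq> ord_zero" "ord_suc \<beta> \<noteq> ord_suc ord_zero"
    using assms ord_suc_le[OF assms(1)] by auto
  ultimately show ?thesis
    using assms by (subst prolong.simps) auto
qed

lemma prolong_limit:
  fixes \<alpha> :: "'o::wellorder"
  assumes "\<alpha> \<noteq> ord_zero" "\<And>\<beta>. \<beta> < \<alpha> \<Longrightarrow> \<alpha> \<noteq> ord_suc \<beta>"
  shows "prolong d F \<alpha> = prolong_step (prolong d F ` {\<beta>. ord_suc ord_zero \<le> \<beta> \<and> \<beta> < \<alpha>})"
proof -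
  have "ord_zero < \<alpha>"
    using assms(1) by (simp add: order.strict_iff_order)
  then have "\<alpha> \<noteq> ord_suc ord_zero" by (rule assms(2))
  then show ?thesis
    using assms by (subst prolong.simps) auto
qed

lemma iterate_one: "iterate R 1 = R"
  by (simp add: iterate_def fun_eq_iff)

lemma iterate_mono:
  assumes "\<And>x. R x \<subseteq> R' x"
  shows "iterate R k p \<subseteq> iterate R' k p"
proof (induction k)
  case (Suc k)
  then show ?case using assms unfolding iterate_def by fastforce
qed (simp add: iterate_def)

lemma prolong_step_mono:
  assumes "\<And>R x. R \<in> S \<Longrightarrow> R x \<subseteq> R' x"
  shows "prolong_step S p \<subseteq> prolong_step {R'} p"
proof
  fix q assume "q \<in> prolong_step S p"
  then obtain P Q k R where "P \<longlonglongrightarrow> p" "Q \<longlonglongrightarrow> q"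
    and *: "\<And>n. k n \<ge> 1 \<and> R n \<in> S \<and> Q n \<in> iterate (R n) (k n) (P n)"
    unfolding prolong_step_def by blast
  moreover have "Q n \<in> iterate R' (k n) (P n)" for n
    using * iterate_mono[of "R n" R' "k n" "P n"] assms[of "R n"] by blast
  ultimately show "q \<in> prolong_step {R'} p"
    unfolding prolong_step_def mem_Collect_eq
    by (intro exI[of _ P] exI[of _ Q] exI[of _ k] exI[of _ "\<lambda>n. R'"]) auto
qed

lemma prolong_step_superset: "R \<in> S \<Longrightarrow> R p \<subseteq> prolong_step S p"
  unfolding prolong_step_def
  by (auto intro!: exI[of _ "\<lambda>n. p"] exI[of _ "\<lambda>n. R"] exI[of _ "\<lambda>n. 1"] exI[of _ "\<lambda>n. q" for q]
      simp: iterate_one[unfolded One_nat_def])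

lemma prolong_mono:
  fixes \<alpha> \<beta> :: "'o::wellorder"
  assumes "\<beta> \<le> \<alpha>"
  shows "prolong d F \<beta> p \<subseteq> prolong d F \<alpha> p"
  using assms
proof (induction \<alpha> arbitrary: \<beta> rule: less_induct)
  case (less \<alpha>)
  show ?case
  proof (cases "\<beta> = \<alpha> \<or> \<beta> = ord_zero")
    case True
    then show ?thesis by (auto simp: prolong_zero)
  next
    case False
    then have \<beta>: "ord_zero < \<beta>" "\<beta> < \<alpha>"
      using less.prems by (auto simp: order.strict_iff_order)
    show ?thesis
    proof (cases "\<exists>\<gamma><\<alpha>. \<alpha> = ord_suc \<gamma>")
      case True
      then obtain \<gamma> where \<gamma>: "\<gamma> < \<alpha>" "\<alpha> = ord_suc \<gamma>" by blast
      have "\<beta> \<le> \<gamma>" using \<gamma> \<beta> ord_suc_le[of \<gamma> \<beta>] by (meson leD not_le)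
      then have "prolong d F \<beta> p \<subseteq> prolong d F \<gamma> p"
        using less.IH \<gamma> by blast
      also have "\<dots> \<subseteq> prolong_step {prolong d F \<gamma>} p"
        by (rule prolong_step_superset) simp
      finally show ?thesis
        using prolong_suc[of \<gamma> d F] \<gamma> \<beta> \<open>\<beta> \<le> \<gamma>\<close> by simp
    next
      case False
      then have "prolong d F \<alpha> = prolong_step (prolong d F ` {\<beta>. ord_suc ord_zero \<le> \<beta> \<and> \<beta> < \<alpha>})"
        using \<beta> by (intro prolong_limit) auto
      moreover have "ord_suc ord_zero \<le> \<beta>" using \<beta> by (intro ord_suc_le)
      ultimately show ?thesis
        using \<beta> prolong_step_superset[of "prolong d F \<beta>"] by auto
    qed
  qed
qed

text \<open>Stages indexed by ordinals from an arbitrary well-ordered type, however long, are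
  contained in \<open>prolong_star\<close>, so that taking the union over \<open>ordinal\<close> only is no restriction.\<close>

lemma prolong_subset_prolong_star:
  fixes \<alpha> :: "'o::wellorder"
  shows "prolong d F \<alpha> p \<subseteq> prolong_star d F p"
proof -
  let ?L = "\<lambda>a :: ordinal. prolong d F a"
  have "\<exists>a. ord_zero < a \<and> (\<forall>p. ?L (ord_suc a) p \<subseteq> ?L a p)"
  proof (rule ccontr)
    assume neg: "\<not> ?thesis"
    have "\<exists>x y. y \<in> ?L (ord_suc (ord_suc a)) x \<and> y \<notin> ?L (ord_suc a) x" for a :: ordinal
      using neg le_less_trans[OF ord_zero_le ordinal_less_suc[of a]] by blast
    then obtain g h where gh: "\<And>a. h a \<in> ?L (ord_suc (ord_suc a)) (g a)"
      "\<And>a. h a \<notin> ?L (ord_suc a) (g a)" by metis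
    have ne: "(g a, h a) \<noteq> (g b, h b)" if "a < b" for a b
    proof
      assume "(g a, h a) = (g b, h b)"
      moreover have "ord_suc a \<le> b" using that by (rule ord_suc_le)
      then have "ord_suc (ord_suc a) \<le> ord_suc b"
        using ordinal_less_suc[of b] by (intro ord_suc_le) (rule le_less_trans)
      then have "?L (ord_suc (ord_suc a)) (g b) \<subseteq> ?L (ord_suc b) (g b)"
        by (rule prolong_mono)
      ultimately show False using gh by (metis Pair_inject subsetD)
    qed
    then have "inj (\<lambda>a. (g a, h a))"
      by (intro injI) (metis linorder_neqE)
    then show False using not_inj_ordinal by blast
  qed
  then obtain a where a: "ord_zero < a" "\<And>p. ?L (ord_suc a) p \<subseteq> ?L a p" by blast
  have a1: "ord_suc ord_zero \<le> a" using a(1) by (rule ord_suc_le)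
  have step: "prolong_step {?L a} p \<subseteq> ?L a p" for p
    using a(2) prolong_suc[OF a(1) ordinal_less_suc, of d F] by simp
  have "prolong d F \<alpha> p \<subseteq> ?L a p" for p
  proof (induction \<alpha> arbitrary: p rule: less_induct)
    case (less \<alpha>)
    consider "\<alpha> = ord_zero" | "\<alpha> \<noteq> ord_zero" "\<alpha> = ord_suc ord_zero"
      | \<gamma> where "ord_zero < \<gamma>" "\<gamma> < \<alpha>" "\<alpha> = ord_suc \<gamma>"
      | "\<alpha> \<noteq> ord_zero" "\<And>\<beta>. \<beta> < \<alpha> \<Longrightarrow> \<alpha> \<noteq> ord_suc \<beta>"
      by (metis ord_zero_le order.strict_iff_order)
    then show ?case
    proof cases
      case 1
      then show ?thesis by (simp add: prolong_zero)
    next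
      case 2
      have "prolong d F \<alpha> = ?L (ord_suc ord_zero)"
        using 2 ordinal_less_suc[of ord_zero] by (simp add: prolong_one)
      then show ?thesis using prolong_mono[OF a1] by simp
    next
      case 3
      then have "prolong d F \<alpha> p = prolong_step {prolong d F \<gamma>} p"
        by (simp add: prolong_suc)
      also have "\<dots> \<subseteq> prolong_step {?L a} p"
        using less[OF 3(2)] by (intro prolong_step_mono) auto
      finally show ?thesis using step by blast
    next
      case 4
      have "prolong d F \<alpha> p = prolong_step (prolong d F ` {\<beta>. ord_suc ord_zero \<le> \<beta> \<and> \<beta> < \<alpha>}) p"
        using 4 by (subst prolong_limit) auto
      also have "\<dots> \<subseteq> prolong_step {?L a} p"
        using less by (intro prolong_step_mono) auto
      finally show ?thesis using step by blast
    qed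
  qed
  then show ?thesis
    using a1 unfolding prolong_star_def ord_nat_def by auto
qed

end

theory Submission
  imports Defs
begin

text \<open>Call two points equivalent if all but finitely many orbits leave them on the same side. In a
  regular flow of the plane no orbit is periodic, every orbit is a closed line, and it separates the
  plane. A jump \<open>y \<in> \<Lambda>\<^sup>1(x)\<close> cannot cross an orbit, hence the points of a finite chain
  of such jumps are equivalent, whereas equivalent points in a common chart lie on the same orbit.
  If chains lead from \<open>p\<^sub>n \<rightarrow> p\<close> to \<open>q\<^sub>n \<rightarrow> q\<close> with infinitely many \<open>p\<^sub>n\<close> off the orbit of \<open>p\<close>, then the
  orbits between three of the \<open>p\<^sub>n\<close> pass near \<open>q\<close>, which forces some \<open>q\<^sub>n\<close> onto the orbit of \<open>p\<^sub>n\<close>. But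
  chains are never cyclic, because a shortest cycle could be shortened by skipping a point. So
  eventually \<open>p\<^sub>n\<close> and, similarly, \<open>q\<^sub>n\<close> are on the orbits of \<open>p\<close> and \<open>q\<close>, and a single chain leads
  from \<open>p\<close> to \<open>q\<close>: the transitive closure of \<open>\<Lambda>\<^sup>1\<close> is closed.\<close>

section \<open>Charts\<close>

text \<open>The inverse of a trivialising homeomorphism, precomposed with a linear map sending the
  horizontal direction to that of the constant flow.\<close>

definition flow_chart :: "(real \<Rightarrow> plane \<Rightarrow> plane) \<Rightarrow> (real \<times> real \<Rightarrow> plane) \<Rightarrow> bool" where
  "flow_chart F e \<longleftrightarrow>
     continuous_on UNIV e \<and> inj e \<and> (\<forall>S. open S \<longrightarrow> open (e ` S)) \<and>
     (\<forall>a b. orbit F (e (a, b)) \<inter> range e = e ` (UNIV \<times> {b}))"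

lemma regular_flow_chart:
  assumes "regular_flow F"
  obtains e where "flow_chart F e" "e (0, 0) = p"
proof -
  obtain v where v: "v \<noteq> 0" and ex: "\<And>p. \<exists>U \<phi> \<psi>. open U \<and> p \<in> U \<and> homeomorphism U UNIV \<phi> \<psi> \<and>
         (\<forall>q\<in>U. \<phi> ` (orbit F q \<inter> U) = orbit (constant_flow v) (\<phi> q))"
    using assms unfolding regular_flow_def by blast
  obtain U \<phi> \<psi> where U: "open U" "p \<in> U" and hom: "homeomorphism U UNIV \<phi> \<psi>"
    and orb: "\<And>q. q \<in> U \<Longrightarrow> \<phi> ` (orbit F q \<inter> U) = orbit (constant_flow v) (\<phi> q)"
    using ex[of p] by blast
  \<comment> \<open>\<open>v\<close> turned by a right angle: together they form an orthogonal frame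
    of vectors of equal length.\<close>
  define w :: plane where "w = vector [- v $ 2, v $ 1]"
  have wv: "w \<bullet> v = 0" "v \<bullet> w = 0"
    by (simp_all add: w_def inner_vec_def sum_2)
  have "w \<noteq> 0"
    using v by (auto simp: w_def vec_eq_iff forall_2)
  \<comment> \<open>\<open>m\<close> sends the horizontal axis to the line through
    \<open>\<phi> p\<close> in direction \<open>v\<close>, so horizontal lines become orbits of the
    constant flow; \<open>n\<close> reads off the coordinates.\<close>
  define m where "m = (\<lambda>(a, b). \<phi> p + a *\<^sub>R v + b *\<^sub>R w)"
  define n where "n = (\<lambda>z. ((z - \<phi> p) \<bullet> v / (v \<bullet> v), (z - \<phi> p) \<bullet> w / (w \<bullet> w)))"
  have nm: "n (m x) = x" for x
    using v \<open>w \<noteq> 0\<close> by (cases x) (simp add: n_def m_def inner_add_left wv)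
  have mn: "m (n z) = z" for z
  proof -
    define y where "y = z - \<phi> p"
    have ww: "w \<bullet> w = v \<bullet> v"
      by (simp add: w_def inner_vec_def sum_2)
    have "((y \<bullet> v) *\<^sub>R v + (y \<bullet> w) *\<^sub>R w) = (v \<bullet> v) *\<^sub>R y"
      by (simp add: vec_eq_iff forall_2 inner_vec_def sum_2 w_def algebra_simps)
    then have "y = inverse (v \<bullet> v) *\<^sub>R ((y \<bullet> v) *\<^sub>R v + (y \<bullet> w) *\<^sub>R w)"
      using v by simp
    then have "(y \<bullet> v / (v \<bullet> v)) *\<^sub>R v + (y \<bullet> w / (w \<bullet> w)) *\<^sub>R w = y"
      by (simp add: ww scaleR_add_right divide_inverse mult.commute)
    then show ?thesis
      by (simp add: m_def n_def y_def algebra_simps)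
  qed
  have cm: "continuous_on UNIV m"
    unfolding m_def case_prod_unfold by (intro continuous_intros)
  have cn: "continuous_on UNIV n"
    unfolding n_def using v \<open>w \<noteq> 0\<close> by (intro continuous_intros) auto
  have hm: "homeomorphism UNIV UNIV m n"
    using cm cn nm mn by (intro homeomorphismI) auto
  define e where "e = \<psi> \<circ> m"
  have he: "homeomorphism UNIV U e (n \<circ> \<phi>)"
    unfolding e_def by (rule homeomorphism_compose[OF hm]) (use hom homeomorphism_sym in blast)
  have \<phi>e: "\<phi> (e x) = m x" for x
    using hom by (simp add: e_def homeomorphism_def)
  have rng: "range e = U"
    using he by (simp add: homeomorphism_def)
  have inje: "inj e"
    by (metis \<phi>e injI nm)
  have "open (e ` S)" if "open S" for S
  proof -
    have "openin (top_of_set U) (e ` S)"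
      using homeomorphism_imp_open_map[OF he, of S] that by simp
    then show ?thesis using U(1) openin_open_eq by blast
  qed
  moreover have "orbit F (e (a, b)) \<inter> range e = e ` (UNIV \<times> {b})" for a b
  proof -
    have "\<phi> ` (orbit F (e (a, b)) \<inter> U) = (\<lambda>t. m (a + t, b)) ` UNIV"
      using orb[of "e (a, b)"] rng
      by (auto simp: \<phi>e orbit_def constant_flow_def m_def algebra_simps)
    also have "\<dots> = m ` (UNIV \<times> {b})"
    proof -
      have "m (c, b) = m (a + (c - a), b)" for c by simp
      then show ?thesis by blast
    qed
    finally have "\<psi> ` \<phi> ` (orbit F (e (a, b)) \<inter> U) = e ` (UNIV \<times> {b})"
      by (simp add: e_def image_comp)
    moreover have "\<psi> (\<phi> x) = x" if "x \<in> U" for x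
      using hom that by (simp add: homeomorphism_def)
    then have "\<psi> ` \<phi> ` (orbit F (e (a, b)) \<inter> U) = orbit F (e (a, b)) \<inter> U"
      by (simp add: image_image cong: image_cong_simp)
    ultimately show ?thesis by (simp add: rng)
  qed
  moreover have "continuous_on UNIV e"
    using he by (simp add: homeomorphism_def)
  ultimately have "flow_chart F e"
    using inje by (simp add: flow_chart_def)
  moreover have "e (0, 0) = p"
    using hom U by (simp add: e_def m_def homeomorphism_def)
  ultimately show ?thesis by (rule that)
qed

section \<open>Separation by lines\<close>

text \<open>The circle in \<open>complex\<close> is exchanged for the sphere of \<open>'a\<close>,
  the form in which the Jordan-Brouwer theorems take a curve.\<close>

lemma simple_loop_homeomorphic_sphere:
  fixes g :: "real \<Rightarrow> 'a::euclidean_space"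
  assumes "DIM('a) = 2" "simple_path g" "pathfinish g = pathstart g"
  shows "path_image g homeomorphic sphere (0::'a) 1"
proof -
  have "sphere (0::complex) 1 homeomorphic sphere (0::'a) 1"
    using assms(1) by (intro homeomorphic_spheres_gen) auto
  with homeomorphic_simple_path_image_circle[OF assms(2,3), of 1 "0::complex"] show ?thesis
    using homeomorphic_trans by auto
qed

text \<open>Inversion at a point off the line turns the line into a Jordan curve through the origin.\<close>

lemma proper_line_separates:
  fixes \<gamma> :: "real \<Rightarrow> 'a::euclidean_space"
  assumes dim: "DIM('a) = 2" and cont: "continuous_on UNIV \<gamma>" and inj: "inj \<gamma>"
    and proper: "\<And>K. compact K \<Longrightarrow> bounded {t. \<gamma> t \<in> K}" and c: "c \<notin> range \<gamma>"
  obtains A B where "open A" "open B" "A \<inter> B = {}" "A \<union> B = - range \<gamma>"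
    "range \<gamma> \<subseteq> closure A" "range \<gamma> \<subseteq> closure B"
proof -
  \<comment> \<open>Inversion about \<open>c\<close>, moved to centre 0, and its inverse; infinity
    corresponds to 0. Division by zero gives \<open>i c = 0\<close>, so \<open>norm_i\<close> holds
    even at \<open>c\<close>.\<close>
  define i where "i = (\<lambda>z. (z - c) /\<^sub>R (norm (z - c))\<^sup>2)"
  define j where "j = (\<lambda>w. c + w /\<^sub>R (norm w)\<^sup>2)"
  have norm_i: "norm (i z) = inverse (norm (z - c))" for z
  proof -
    have "norm (i z) = norm (z - c) / (norm (z - c))\<^sup>2"
      by (simp add: i_def divide_inverse mult.commute)
    then show ?thesis by (simp add: power2_eq_square inverse_eq_divide)
  qed
  have cancel: "r * r * (inverse r * inverse r) = 1" if "r \<noteq> 0" for r :: real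
    using that by (simp add: field_simps)
  have ji: "j (i z) = z" if "z \<noteq> c" for z
  proof -
    have "norm (z - c) * norm (z - c) * (inverse (norm (z - c)) * inverse (norm (z - c))) = 1"
      using that cancel by simp
    then show ?thesis
      unfolding j_def norm_i by (simp add: i_def power2_eq_square)
  qed
  have j_ne: "j w \<noteq> c" if "w \<noteq> 0" for w
    using that by (simp add: j_def)
  have ij: "i (j w) = w" if "w \<noteq> 0" for w
  proof -
    have "norm (w /\<^sub>R (norm w)\<^sup>2) = norm w / (norm w)\<^sup>2"
      by (simp add: divide_inverse mult.commute)
    then have "norm (w /\<^sub>R (norm w)\<^sup>2) = inverse (norm w)"
      by (simp add: power2_eq_square inverse_eq_divide)
    then have "i (j w) = (norm w * norm w * (inverse (norm w) * inverse (norm w))) *\<^sub>R w"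
      by (simp add: i_def j_def power2_eq_square del: norm_scaleR)
    then show ?thesis
      using that cancel by simp
  qed
  have ci: "continuous_on (- {c}) i"
    unfolding i_def by (intro continuous_intros) auto
  have cj: "isCont j w" if "w \<noteq> 0" for w
    unfolding j_def using that by (intro continuous_intros) auto
  \<comment> \<open>\<open>tan \<circ> u\<close> maps the open unit interval onto the parameter line
    of \<gamma>; both endpoints are sent to 0, the image of infinity.\<close>
  define u :: "real \<Rightarrow> real" where "u = (\<lambda>t. pi * (t - 1/2))"
  define g where "g = (\<lambda>t. if 0 < t \<and> t < 1 then i (\<gamma> (tan (u t))) else 0)"
  have u: "- (pi/2) < u t" "u t < pi/2" if "0 < t" "t < 1" for t
  proof -
    have "pi * (- (1/2)) < u t" "u t < pi * (1/2)"
      unfolding u_def using that by (intro mult_strict_left_mono; simp)+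
    then show "- (pi/2) < u t" "u t < pi/2" by simp_all
  qed
  have g_ne: "g t \<noteq> 0" if "0 < t" "t < 1" for t
    using that c by (auto simp: g_def i_def)
  \<comment> \<open>Properness: the line finally leaves every ball about \<open>c\<close>, so its
    inversion tends to 0 at both ends.\<close>
  have small: "\<exists>b. \<forall>s. b < \<bar>s\<bar> \<longrightarrow> norm (i (\<gamma> s)) < \<epsilon>" if "\<epsilon> > 0" for \<epsilon>
  proof -
    obtain b where b: "\<And>s. \<gamma> s \<in> cball c (inverse \<epsilon>) \<Longrightarrow> \<bar>s\<bar> \<le> b"
      using proper[OF compact_cball, of c "inverse \<epsilon>"] by (auto simp: bounded_iff)
    have "norm (i (\<gamma> s)) < \<epsilon>" if "b < \<bar>s\<bar>" for s
    proof -
      have "inverse \<epsilon> < norm (\<gamma> s - c)"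
        using b[of s] that by (force simp: dist_norm norm_minus_commute)
      then show ?thesis
        unfolding norm_i using \<open>\<epsilon> > 0\<close> by (metis inverse_inverse_eq inverse_less_iff_less
            inverse_positive_iff_positive order.strict_trans)
    qed
    then show ?thesis by blast
  qed
  have end_lim: "((\<lambda>t. i (\<gamma> (tan (u t)))) \<longlongrightarrow> 0) G" if "filterlim (\<lambda>t. tan (u t)) at_infinity G" for G
  proof (rule tendstoI)
    fix \<epsilon> :: real assume "0 < \<epsilon>"
    then obtain b where b: "\<And>s. b < \<bar>s\<bar> \<Longrightarrow> norm (i (\<gamma> s)) < \<epsilon>" using small by blast
    have "\<forall>\<^sub>F t in G. \<bar>b\<bar> + 1 \<le> norm (tan (u t))"
      using that unfolding filterlim_at_infinity[OF order_refl] by (metis abs_ge_zero add_nonneg_pos zero_less_one)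
    then show "\<forall>\<^sub>F t in G. dist (i (\<gamma> (tan (u t)))) 0 < \<epsilon>"
      by eventually_elim (use b in \<open>auto simp: dist_norm\<close>)
  qed
  have lim0: "filterlim (\<lambda>t. tan (u t)) at_infinity (at_right 0)"
  proof -
    have "filterlim u (at_right (- (pi/2))) (at_right 0)"
      unfolding filterlim_at
    proof
      show "(u \<longlongrightarrow> - (pi/2)) (at_right 0)"
        unfolding u_def by (auto intro!: tendsto_eq_intros)
      show "\<forall>\<^sub>F t in at_right 0. u t \<in> {- (pi/2)<..} \<and> u t \<noteq> - (pi/2)"
        using eventually_at_right_real[of 0 1] by (auto elim!: eventually_mono dest!: u(1))
    qed
    then show ?thesis
      using filterlim_compose[OF filterlim_tan_at_right] filterlim_mono[OF _ at_bot_le_at_infinity order_refl]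
      by blast
  qed
  have lim1: "filterlim (\<lambda>t. tan (u t)) at_infinity (at_left 1)"
  proof -
    have "filterlim u (at_left (pi/2)) (at_left 1)"
      unfolding filterlim_at
    proof
      show "(u \<longlongrightarrow> pi/2) (at_left 1)"
        unfolding u_def by (auto intro!: tendsto_eq_intros)
      show "\<forall>\<^sub>F t in at_left 1. u t \<in> {..<pi/2} \<and> u t \<noteq> pi/2"
        using eventually_at_left_real[of 0 1] by (auto elim!: eventually_mono dest!: u(2))
    qed
    then show ?thesis
      using filterlim_compose[OF filterlim_tan_at_left] filterlim_mono[OF _ at_top_le_at_infinity order_refl]
      by blast
  qed
  have "continuous_on {0..1} g"
  proof (rule continuous_on_IccI)
    have "\<forall>\<^sub>F t in at_right 0. i (\<gamma> (tan (u t))) = g t"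
      using eventually_at_right_real[of 0 1] by (auto elim!: eventually_mono simp: g_def)
    then show "(g \<longlongrightarrow> g 0) (at_right 0)"
      using end_lim[OF lim0] by (simp add: g_def tendsto_cong)
    have "\<forall>\<^sub>F t in at_left 1. i (\<gamma> (tan (u t))) = g t"
      using eventually_at_left_real[of 0 1] by (auto elim!: eventually_mono simp: g_def)
    then show "(g \<longlongrightarrow> g 1) (at_left 1)"
      using end_lim[OF lim1] by (simp add: g_def tendsto_cong)
    have "continuous_on {0<..<1} (\<lambda>t. tan (u t))"
    proof (rule Transcendental.continuous_on_tan)
      show "continuous_on {0<..<1} u" unfolding u_def by (intro continuous_intros)
      show "\<forall>t\<in>{0<..<1}. cos (u t) \<noteq> 0"
        using u cos_gt_zero_pi by force
    qed
    then have "continuous_on {0<..<1} (\<lambda>t. \<gamma> (tan (u t)))"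
      by (rule continuous_on_compose2[OF cont]) auto
    then have "continuous_on {0<..<1} (\<lambda>t. i (\<gamma> (tan (u t))))"
      by (rule continuous_on_compose2[OF ci]) (use c in auto)
    then have cg: "continuous_on {0<..<1} g"
      by (rule continuous_on_eq) (auto simp: g_def)
    show "g \<midarrow>t\<rightarrow> g t" if "0 < t" "t < 1" for t
      using cg that by (simp add: continuous_on_eq_continuous_at isCont_def)
  qed simp
  then have path: "path g" by (simp add: path_def)
  have "simple_path g"
  proof (rule simple_pathI[OF path])
    fix x y :: real assume xy: "0 \<le> x" "x < y" "y \<le> 1" "g x = g y"
    show "x = 0 \<and> y = 1"
    proof (rule ccontr)
      assume "\<not> ?thesis"
      then consider "0 < x" "y = 1" | "x = 0" "y < 1" | "0 < x" "y < 1"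
        using xy by linarith
      then show False
      proof cases
        case 1
        then show False using g_ne[of x] xy by (simp add: g_def)
      next
        case 2
        then show False using g_ne[of y] xy by (simp add: g_def)
      next
        case 3
        then have "i (\<gamma> (tan (u x))) = i (\<gamma> (tan (u y)))"
          using xy by (simp add: g_def)
        then have "\<gamma> (tan (u x)) = \<gamma> (tan (u y))"
          using ji c by (metis rangeI)
        then have "tan (u x) = tan (u y)" using inj by (simp add: inj_eq)
        then have "u x = u y"
          using u[of x] u[of y] 3 xy arctan_tan by (metis order.strict_trans)
        then show False using xy by (simp add: u_def)
      qed
    qed
  qed
  moreover have loop: "pathfinish g = pathstart g"
    by (simp add: pathfinish_def pathstart_def g_def)
  ultimately have hom: "path_image g homeomorphic sphere (0::'a) 1"
    using simple_loop_homeomorphic_sphere[OF dim] by blast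
  define S where "S = path_image g"
  have S: "w \<in> S \<longleftrightarrow> w = 0 \<or> (\<exists>s. w = i (\<gamma> s))" for w
  proof
    assume "w \<in> S"
    then show "w = 0 \<or> (\<exists>s. w = i (\<gamma> s))"
      by (auto simp: S_def path_image_def g_def)
  next
    have "g 0 = 0" by (simp add: g_def)
    then have 0: "0 \<in> S" by (force simp: S_def path_image_def)
    have "i (\<gamma> s) \<in> S" for s
    proof -
      define t where "t = arctan s / pi + 1/2"
      have ut: "u t = arctan s" by (simp add: u_def t_def)
      have "- (1/2) < arctan s / pi" "arctan s / pi < 1/2"
        using arctan[of s] by (simp_all add: field_simps)
      then have t: "0 < t" "t < 1" unfolding t_def by linarith+
      then have "g t = i (\<gamma> s)" by (simp add: g_def ut tan_arctan)
      then show ?thesis using t imageI[of t "{0..1}" g] by (simp add: S_def path_image_def)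
    qed
    then show "w \<in> S" if "w = 0 \<or> (\<exists>s. w = i (\<gamma> s))" using that 0 by blast
  qed
  have Si: "i z \<in> S \<longleftrightarrow> z \<in> range \<gamma>" if "z \<noteq> c" for z
  proof -
    have "z = \<gamma> s" if "i z = i (\<gamma> s)" for s
      using that ji[OF \<open>z \<noteq> c\<close>] ji[of "\<gamma> s"] c by (metis rangeI)
    moreover have "i z \<noteq> 0" using that by (simp add: i_def)
    ultimately show ?thesis unfolding S by blast
  qed
  have nc: "\<not> connected (- S)"
    using Jordan_Brouwer_separation[OF hom] by (simp add: S_def)
  have bS: "bounded (- (- S))"
    using bounded_path_image[OF path] by (simp add: S_def)
  \<comment> \<open>\<open>T\<close> is an inner component. A second component \<open>T2\<close> has
    the same frontier and shows that the curve is also approached from outside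
    \<open>closure T\<close>.\<close>
  obtain T where T: "T \<in> components (- S)" "bounded T"
    using cobounded_has_bounded_component[OF bS nc] dim by auto
  have "T \<subseteq> - S" using T(1) by (rule in_components_subset)
  have "T \<noteq> - S" using nc T(1) in_components_connected by blast
  then obtain T2 where T2: "T2 \<in> components (- S)" "T2 \<noteq> T"
    using Union_components[of "- S"] \<open>T \<subseteq> - S\<close> by blast
  have frT: "frontier T = S" and frT2: "frontier T2 = S"
    using Jordan_Brouwer_frontier[OF hom] T(1) T2(1) dim by (auto simp: S_def)
  have clT: "closure T = T \<union> S"
    unfolding closure_Un_frontier frT ..
  have clT2: "S \<subseteq> closure T2"
    unfolding closure_Un_frontier frT2 by blast
  have "T2 \<inter> T = {}" "T2 \<inter> S = {}"
    using components_eq[OF T2(1) T(1)] T2 in_components_subset[OF T2(1)] by auto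
  have oT: "open T"
    using T(1) open_components[of "- S"] compact_path_image[OF path] by (simp add: S_def open_Compl compact_imp_closed)
  obtain M where M: "M > 0" "\<And>w. w \<in> closure T \<Longrightarrow> norm w \<le> M"
    using bounded_closure[OF T(2)] unfolding bounded_pos by blast
  \<comment> \<open>\<open>T\<close> is bounded, so its preimage stays away from \<open>c\<close>.
    The set \<open>- closure T\<close> contains a neighbourhood of infinity, so its preimage
    \<open>V\<close> contains a punctured ball about \<open>c\<close> and remains open when
    \<open>c\<close> is added.\<close>
  define A where "A = {z \<in> - {c}. i z \<in> T}"
  define V where "V = {z \<in> - {c}. i z \<in> - closure T}"
  define B where "B = V \<union> ball c (inverse M)"
  have "A = - {c} \<inter> i -` T" "V = - {c} \<inter> i -` (- closure T)"
    by (auto simp: A_def V_def)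
  then have "open A" "open V"
    using continuous_open_preimage[OF ci _ oT] continuous_open_preimage[OF ci, of "- closure T"]
    by (simp_all add: open_Compl)
  have ballV: "z \<in> V" if "z \<in> ball c (inverse M)" "z \<noteq> c" for z
  proof -
    have "norm (z - c) < inverse M" using that by (simp add: dist_norm norm_minus_commute)
    then have "M < norm (i z)"
      unfolding norm_i using M(1) that(2)
      by (metis inverse_inverse_eq inverse_less_iff_less positive_imp_inverse_positive
          right_minus_eq zero_less_norm_iff)
    then show ?thesis using M(2)[of "i z"] that(2) by (force simp: V_def)
  qed
  show ?thesis
  proof
    show "open A" by fact
    show "open B" unfolding B_def using \<open>open V\<close> by auto
    have BV: "B = insert c V"
      using ballV M(1) by (auto simp: B_def simp del: mem_ball)
    show "A \<inter> B = {}"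
      unfolding BV using closure_subset by (auto simp: A_def V_def)
    show "A \<union> B = - range \<gamma>"
      unfolding BV using Si c \<open>T \<subseteq> - S\<close> by (auto simp: A_def V_def clT)
    show "range \<gamma> \<subseteq> closure A"
    proof
      fix z assume z: "z \<in> range \<gamma>"
      then have zc: "z \<noteq> c" "i z \<noteq> 0" using c norm_i[of z] by auto
      then have "i z \<in> closure T" using Si z clT by blast
      then obtain w where w: "\<And>n. w n \<in> T" "w \<longlonglongrightarrow> i z"
        by (auto simp: closure_sequential)
      have "w n \<noteq> 0" for n
        using w(1)[of n] \<open>T \<subseteq> - S\<close> S[of 0] by auto
      then have "j (w n) \<in> A" for n
        using w(1)[of n] j_ne ij by (auto simp: A_def)
      moreover have "(\<lambda>n. j (w n)) \<longlonglongrightarrow> z"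
        using isCont_tendsto_compose[OF cj[OF zc(2)] w(2)] ji[OF zc(1)] by simp
      ultimately show "z \<in> closure A"
        by (auto simp: closure_sequential intro!: exI[of _ "\<lambda>n. j (w n)"])
    qed
    show "range \<gamma> \<subseteq> closure B"
    proof
      fix z assume z: "z \<in> range \<gamma>"
      then have zc: "z \<noteq> c" "i z \<noteq> 0" using c norm_i[of z] by auto
      then have "i z \<in> closure T2" using Si z clT2 by blast
      then obtain w where w: "\<And>n. w n \<in> T2" "w \<longlonglongrightarrow> i z"
        by (auto simp: closure_sequential)
      have "w n \<noteq> 0" for n
        using w(1)[of n] \<open>T2 \<inter> S = {}\<close> S[of 0] by auto
      then have "j (w n) \<in> V" for n
        using w(1)[of n] \<open>T2 \<inter> T = {}\<close> \<open>T2 \<inter> S = {}\<close> j_ne ij by (auto simp: V_def clT)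
      then have "j (w n) \<in> B" for n by (simp add: BV)
      moreover have "(\<lambda>n. j (w n)) \<longlonglongrightarrow> z"
        using isCont_tendsto_compose[OF cj[OF zc(2)] w(2)] ji[OF zc(1)] by simp
      ultimately show "z \<in> closure B"
        by (auto simp: closure_sequential intro!: exI[of _ "\<lambda>n. j (w n)"])
    qed
  qed
qed

section \<open>Orbits of a regular flow\<close>

text \<open>The direction of the constant flow is already absorbed into the charts.\<close>

locale planar_flow =
  fixes F :: "real \<Rightarrow> plane \<Rightarrow> plane"
  assumes continuous_flow: "continuous_on UNIV (\<lambda>(t, x). F t x)"
    and flow_add: "F t (F s x) = F (t + s) x"
    and flow_zero [simp]: "F 0 x = x"
    and chart_at: "\<exists>e. flow_chart F e \<and> e (0, 0) = p"
begin

lemma continuous_on_time: "continuous_on S (\<lambda>t. F t x)"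
  using continuous_on_compose2[OF continuous_flow, of S "\<lambda>t. (t, x)"]
  by (simp add: continuous_on_Pair continuous_on_id)

lemma continuous_on_space: "continuous_on S (F t)"
  using continuous_on_compose2[OF continuous_flow, of S "\<lambda>x. (t, x)"]
  by (simp add: continuous_on_Pair continuous_on_id)

lemma open_flow_vimage: "open S \<Longrightarrow> open (F t -` S)"
  by (rule open_vimage[OF _ continuous_on_space])

lemma open_time_vimage: "open S \<Longrightarrow> open ((\<lambda>t. F t x) -` S)"
  by (rule open_vimage[OF _ continuous_on_time])

lemma mem_orbit: "y \<in> orbit F x \<longleftrightarrow> (\<exists>t. y = F t x)"
  by (auto simp: orbit_def)

lemma flow_mem_orbit [simp]: "F t x \<in> orbit F x"
  by (auto simp: orbit_def)

lemma orbit_refl [simp]: "x \<in> orbit F x"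
  using flow_mem_orbit[of 0 x] by simp

lemma orbit_eq: "y \<in> orbit F x \<Longrightarrow> orbit F y = orbit F x"
proof -
  have "orbit F (F s x) = orbit F x" for s
  proof (intro equalityI subsetI)
    fix z assume "z \<in> orbit F x"
    then obtain t where "z = F t x" by (auto simp: mem_orbit)
    then have "z = F (t - s) (F s x)" by (simp add: flow_add)
    then show "z \<in> orbit F (F s x)" by (metis flow_mem_orbit)
  qed (auto simp: mem_orbit flow_add)
  then show "y \<in> orbit F x \<Longrightarrow> ?thesis" by (auto simp: mem_orbit)
qed

lemma orbit_flow [simp]: "orbit F (F t x) = orbit F x"
  by (simp add: orbit_eq)

lemma orbit_sym: "y \<in> orbit F x \<longleftrightarrow> x \<in> orbit F y"
  by (metis orbit_eq orbit_refl)

lemma orbit_disjoint: "y \<notin> orbit F x \<Longrightarrow> orbit F y \<inter> orbit F x = {}"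
  by (metis disjoint_iff orbit_eq orbit_refl)

lemma connected_orbit: "connected (orbit F x)"
  unfolding orbit_def by (intro connected_continuous_image continuous_on_time) auto

text \<open>By injectivity of the chart, an orbit that meets it fills exactly one horizontal level
  and never returns at another height.\<close>

lemma chart_mem_orbit:
  assumes "flow_chart F e"
  shows "e (a', b') \<in> orbit F (e (a, b)) \<longleftrightarrow> b' = b"
proof -
  have "e (a', b') \<in> orbit F (e (a, b)) \<longleftrightarrow> e (a', b') \<in> e ` (UNIV \<times> {b})"
    using assms unfolding flow_chart_def by blast
  also have "\<dots> \<longleftrightarrow> b' = b"
    using assms unfolding flow_chart_def by (auto dest: injD)
  finally show ?thesis .
qed

text \<open>A limit point off the orbit would be at level 0 of a chart which the orbit meets at a
  single level \<open>b \<noteq> 0\<close>. Removing that level leaves a neighbourhood of the point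
  that misses the orbit.\<close>

lemma closed_orbit: "closed (orbit F x)"
proof (rule ccontr)
  assume "\<not> closed (orbit F x)"
  then obtain y where y: "y \<in> closure (orbit F x)" "y \<notin> orbit F x"
    using closure_subset_eq by blast
  obtain e where e: "flow_chart F e" "e (0, 0) = y"
    using chart_at by blast
  have op: "open (e ` S)" if "open S" for S
    using e that by (simp add: flow_chart_def)
  have "range e \<inter> orbit F x \<noteq> {}"
    using y(1) open_Int_closure_eq_empty[OF op[OF open_UNIV], of "orbit F x"] e(2) by blast
  then obtain a b where ab: "e (a, b) \<in> orbit F x" by auto
  then have x: "orbit F x = orbit F (e (a, b))" by (simp add: orbit_eq)
  have "b \<noteq> 0" using y(2) chart_mem_orbit[OF e(1), of 0 0 a b] e(2) x by auto
  then have "open (e ` (UNIV \<times> - {b}))" "y \<in> e ` (UNIV \<times> - {b})"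
    using e(2) by (auto intro!: op open_Times image_eqI[of _ _ "(0, 0)"])
  then have "e ` (UNIV \<times> - {b}) \<inter> orbit F x \<noteq> {}"
    using y(1) open_Int_closure_eq_empty by blast
  then show False
    using chart_mem_orbit[OF e(1)] x by auto
qed

section \<open>Flow boxes and the times at which an orbit visits them\<close>

definition cell :: "(real \<times> real \<Rightarrow> plane) \<Rightarrow> real \<Rightarrow> plane set" where
  "cell e r = e ` ({-r<..<r} \<times> {-r<..<r})"

lemma open_cell: "flow_chart F e \<Longrightarrow> open (cell e r)"
  unfolding cell_def flow_chart_def by (blast intro: open_Times open_greaterThanLessThan)

lemma connected_chart_Times:
  "flow_chart F e \<Longrightarrow> connected I \<Longrightarrow> connected J \<Longrightarrow> connected (e ` (I \<times> J))"
  unfolding flow_chart_def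
  by (intro connected_continuous_image connected_Times) (auto intro: continuous_on_subset)

lemma connected_cell: "flow_chart F e \<Longrightarrow> connected (cell e r)"
  unfolding cell_def by (intro connected_chart_Times) auto

lemma centre_mem_cell: "0 < r \<Longrightarrow> e (0, 0) \<in> cell e r"
  by (auto simp: cell_def)

lemma cell_subset:
  assumes "flow_chart F e" "open N" "e (0, 0) \<in> N"
  obtains r where "0 < r" "cell e r \<subseteq> N"
proof -
  have "open (e -` N)"
    using assms by (intro open_vimage) (auto simp: flow_chart_def)
  then obtain A B where AB: "open A" "open B" "0 \<in> A" "0 \<in> B" "A \<times> B \<subseteq> e -` N"
    using assms(3) by (metis open_prod_elim mem_Sigma_iff vimage_eq)
  obtain r s where rs: "0 < r" "ball 0 r \<subseteq> A" "0 < s" "ball 0 s \<subseteq> B"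
    using AB openE by metis
  have "cell e (min r s) \<subseteq> N"
  proof
    fix z assume "z \<in> cell e (min r s)"
    then obtain a b where ab: "z = e (a, b)" "\<bar>a\<bar> < r" "\<bar>b\<bar> < s"
      by (auto simp: cell_def)
    then have "a \<in> A" "b \<in> B"
      using rs by (auto simp: dist_norm)
    then show "z \<in> N" using AB(5) ab(1) by blast
  qed
  then show ?thesis using that[of "min r s"] rs by simp
qed

text \<open>An aperiodic orbit passes through a cell during a single time interval. Otherwise the
  disjoint open time intervals would be mapped by the first coordinate, injectively and hence
  openly, onto disjoint open sets covering a connected horizontal segment.\<close>

lemma hitting_times_convex:
  assumes e: "flow_chart F e" and inj: "inj (\<lambda>t. F t x)"
    and s: "F s x \<in> cell e r" and t: "F t x \<in> cell e r" and u: "s \<le> u" "u \<le> t"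
  shows "F u x \<in> cell e r"
proof (rule ccontr)
  assume nu: "F u x \<notin> cell e r"
  define I where "I = {-r<..<r}"
  define J where "J = {t. F t x \<in> cell e r}"
  obtain a0 b0 where b0: "F s x = e (a0, b0)" "b0 \<in> I"
    using s by (auto simp: cell_def I_def)
  have orb: "orbit F (e (a0, b0)) = orbit F x"
    using orbit_flow[of s x] b0 by simp
  have inje: "inj e" using e by (simp add: flow_chart_def)
  have ce: "continuous_on (range e) (inv e)"
  proof (rule continuous_on_inverse_open_map)
    show "openin (top_of_set (range e)) (e ` U)" if "openin (top_of_set UNIV) U" for U
      using that e unfolding flow_chart_def by (metis open_openin open_subset subtopology_UNIV
          image_mono subset_UNIV)
  qed (use e inje in \<open>auto simp: flow_chart_def\<close>)
  have coord: "\<exists>a\<in>I. F t x = e (a, b0)" if "t \<in> J" for t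
  proof -
    have "F t x \<in> e ` (I \<times> I)"
      using that by (simp add: J_def cell_def I_def)
    then obtain a b where ab: "F t x = e (a, b)" "a \<in> I"
      by blast
    have "e (a, b) \<in> orbit F (e (a0, b0))"
      using orb ab(1) flow_mem_orbit[of t x] by simp
    then have "b = b0" using chart_mem_orbit[OF e] by blast
    then show ?thesis using ab by blast
  qed
  define \<alpha> where "\<alpha> = (\<lambda>t. fst (inv e (F t x)))"
  have \<alpha>: "\<alpha> t \<in> I \<and> F t x = e (\<alpha> t, b0)" if "t \<in> J" for t
    using coord[OF that] inje by (auto simp: \<alpha>_def)
  \<comment> \<open>The orbit contains the whole level \<open>b0\<close> of the chart, not only the
    part visited near time \<open>s\<close>.\<close>
  have surj: "\<exists>t\<in>J. \<alpha> t = a" if "a \<in> I" for a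
  proof -
    have "e (a, b0) \<in> orbit F x"
      using chart_mem_orbit[OF e, of a b0 a0 b0] orb by simp
    then obtain t where t: "e (a, b0) = F t x" by (auto simp: mem_orbit)
    then have "t \<in> J" using that b0(2)
      by (auto simp: J_def cell_def I_def intro!: image_eqI[of _ e "(a, b0)"])
    moreover have "\<alpha> t = a" using inje by (simp add: \<alpha>_def t[symmetric])
    ultimately show ?thesis by blast
  qed
  have c\<alpha>: "continuous_on J \<alpha>"
    unfolding \<alpha>_def
    by (rule continuous_on_fst, rule continuous_on_compose2[OF ce continuous_on_time])
      (auto simp: J_def cell_def)
  have "inj_on \<alpha> J"
  proof (rule inj_onI)
    fix t t' assume "t \<in> J" "t' \<in> J" "\<alpha> t = \<alpha> t'"
    then have "F t x = F t' x" using \<alpha>[of t] \<alpha>[of t'] by simp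
    then show "t = t'" using injD[OF inj] by simp
  qed
  have oJ: "open J"
    unfolding J_def using open_time_vimage[OF open_cell[OF e], of x r] by (simp add: vimage_def)
  define J1 J2 where "J1 = J \<inter> {..<u}" and "J2 = J \<inter> {u<..}"
  have JJ: "J = J1 \<union> J2" "J1 \<inter> J2 = {}" "open J1" "open J2" "J1 \<subseteq> J" "J2 \<subseteq> J"
    using nu oJ by (auto simp: J_def J1_def J2_def not_less le_less)
  have "open (\<alpha> ` J1)" "open (\<alpha> ` J2)"
    using JJ c\<alpha> \<open>inj_on \<alpha> J\<close>
    by (auto intro!: invariance_of_domain intro: continuous_on_subset inj_on_subset)
  moreover have "\<alpha> ` J1 \<inter> \<alpha> ` J2 = {}"
    using JJ \<open>inj_on \<alpha> J\<close> by (auto dest: inj_onD)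
  moreover have "I \<subseteq> \<alpha> ` J1 \<union> \<alpha> ` J2"
    using surj JJ(1) by blast
  moreover have "s \<in> J1" "t \<in> J2"
    using s t u nu by (auto simp: J1_def J2_def J_def less_le)
  then have "\<alpha> ` J1 \<inter> I \<noteq> {}" "\<alpha> ` J2 \<inter> I \<noteq> {}"
    using \<alpha> JJ by blast+
  moreover have "connected I" by (simp add: I_def)
  ultimately show False
    using connectedD[of I "\<alpha> ` J1" "\<alpha> ` J2"] by (simp add: Int_assoc Int_commute)
qed

section \<open>Aperiodicity\<close>

text \<open>The orbit contains the whole chart level through \<open>x\<close>.\<close>

lemma orbit_not_singleton: "\<exists>t. F t x \<noteq> x"
proof -
  obtain e where e: "flow_chart F e" "e (0, 0) = x"
    using chart_at by blast
  have "e (1, 0) \<noteq> x"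
    using e injD[of e "(1, 0)" "(0, 0)"] by (auto simp: flow_chart_def)
  moreover have "e (1, 0) \<in> orbit F x"
    using chart_mem_orbit[OF e(1), of 1 0 0 0] e(2) by simp
  ultimately show ?thesis by (auto simp: mem_orbit)
qed

text \<open>Combined with convexity of hitting times, such a cell prevents an aperiodic orbit from
  visiting it at two times that differ by 1 or more.\<close>

lemma displaced_cell:
  assumes "F 1 y \<noteq> y"
  obtains e r where "flow_chart F e" "e (0, 0) = y" "0 < r" "\<And>w. w \<in> cell e r \<Longrightarrow> F 1 w \<notin> cell e r"
proof -
  obtain A B where AB: "open A" "open B" "y \<in> A" "F 1 y \<in> B" "A \<inter> B = {}"
    using hausdorff[of y "F 1 y"] assms by auto
  obtain e where e: "flow_chart F e" "e (0, 0) = y"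
    using chart_at by blast
  have "open (A \<inter> F 1 -` B)" "e (0, 0) \<in> A \<inter> F 1 -` B"
    using AB e(2) open_flow_vimage by auto
  then obtain r where r: "0 < r" "cell e r \<subseteq> A \<inter> F 1 -` B"
    using cell_subset[OF e(1)] by blast
  then have "F 1 w \<notin> cell e r" if "w \<in> cell e r" for w
    using that AB(5) by blast
  then show ?thesis using that e r(1) by blast
qed

text \<open>Two visits to a displaced cell at distance at least 1 would, by convexity, give visits
  at some \<open>s\<close> and at \<open>s + 1\<close>.\<close>

lemma short_hitting_times:
  assumes inj: "inj (\<lambda>t. F t x)" and y: "y \<in> orbit F x"
  obtains N where "open N" "y \<in> N" "\<And>s t. F s x \<in> N \<Longrightarrow> F t x \<in> N \<Longrightarrow> \<bar>s - t\<bar> < 1"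
proof -
  obtain r where r: "y = F r x" using y by (auto simp: mem_orbit)
  have "F 1 y \<noteq> y"
    using injD[OF inj, of "1 + r" r] by (auto simp: r flow_add)
  then obtain e \<delta> where e: "flow_chart F e" "e (0, 0) = y" and \<delta>: "0 < \<delta>"
    "\<And>w. w \<in> cell e \<delta> \<Longrightarrow> F 1 w \<notin> cell e \<delta>"
    using displaced_cell by metis
  have *: "t < s + 1" if "F s x \<in> cell e \<delta>" "F t x \<in> cell e \<delta>" for s t
  proof (rule ccontr)
    assume "\<not> t < s + 1"
    then have "F (s + 1) x \<in> cell e \<delta>"
      using hitting_times_convex[OF e(1) inj that, of "s + 1"] by simp
    then show False using \<delta>(2)[OF that(1)] by (simp add: flow_add add.commute)
  qed
  show ?thesis
  proof
    show "open (cell e \<delta>)" by (rule open_cell[OF e(1)])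
    show "y \<in> cell e \<delta>" using centre_mem_cell[OF \<delta>(1), of e] e(2) by simp
    show "\<bar>s - t\<bar> < 1" if "F s x \<in> cell e \<delta>" "F t x \<in> cell e \<delta>" for s t
      using *[OF that] *[OF that(2,1)] by linarith
  qed
qed

text \<open>Every point has a neighbourhood with bounded hitting times: by short visits if it is on
  the orbit, and with no visits at all if it is off the closed orbit. Finitely many of them cover
  \<open>K\<close>.\<close>

lemma aperiodic_orbit_proper:
  assumes inj: "inj (\<lambda>t. F t x)" and K: "compact K"
  shows "bounded {t. F t x \<in> K}"
proof -
  have "\<exists>N. open N \<and> y \<in> N \<and> bounded {t. F t x \<in> N}" for y
  proof (cases "y \<in> orbit F x")
    case True
    obtain N where N: "open N" "y \<in> N" "\<And>s t. F s x \<in> N \<Longrightarrow> F t x \<in> N \<Longrightarrow> \<bar>s - t\<bar> < 1"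
      using short_hitting_times[OF inj True] by blast
    obtain s where "F s x \<in> N" using True N(2) by (auto simp: mem_orbit)
    then have "{t. F t x \<in> N} \<subseteq> ball s 1" using N(3) by (auto simp: dist_real_def)
    then have "bounded {t. F t x \<in> N}" by (rule bounded_subset[OF bounded_ball])
    then show ?thesis using N(1,2) by (intro exI[of _ N]) auto
  next
    case False
    then show ?thesis
      by (intro exI[of _ "- orbit F x"]) (auto simp: closed_orbit open_Compl)
  qed
  then obtain N where N: "\<And>y. open (N y)" "\<And>y. y \<in> N y" "\<And>y. bounded {t. F t x \<in> N y}"
    by metis
  obtain C where C: "C \<subseteq> K" "finite C" "K \<subseteq> (\<Union>y\<in>C. N y)"
    using compactE_image[OF K, of K N] N by blast
  then have "{t. F t x \<in> K} \<subseteq> (\<Union>y\<in>C. {t. F t x \<in> N y})" by blast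
  moreover have "bounded (\<Union>y\<in>C. {t. F t x \<in> N y})"
    using C(2) N(3) by (intro bounded_UN) auto
  ultimately show ?thesis by (rule bounded_subset[rotated])
qed

section \<open>Periodic orbits as Jordan curves\<close>

lemma flow_period_multiple: "F T x = x \<Longrightarrow> F (of_int k * T) x = x"
proof (induction k rule: int_induct[where k = 0])
  case (step1 k)
  then have "F (of_int k * T) (F T x) = x" by simp
  then show ?case by (simp add: flow_add algebra_simps)
next
  case (step2 k)
  have "F ((of_int k - 1) * T) (F T x) = F (of_int k * T) x"
    unfolding flow_add by (simp add: algebra_simps)
  then show ?case using step2 by simp
qed simp

lemma periodic_orbit_image:
  assumes "F T x = x" "0 < T"
  shows "orbit F x = (\<lambda>t. F t x) ` {0..T}"
proof -
  have "F t x \<in> (\<lambda>t. F t x) ` {0..T}" for t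
  proof -
    define k where "k = \<lfloor>t / T\<rfloor>"
    have "of_int k * T \<le> t" "t < (of_int k + 1) * T"
      using floor_divide_lower[OF assms(2)] floor_divide_upper[OF assms(2)] by (simp_all add: k_def)
    then have "t - of_int k * T \<in> {0..T}" by (simp add: algebra_simps)
    moreover have "F (t - of_int k * T) x = F t x"
      using flow_period_multiple[OF assms(1), of k] flow_add[of "t - of_int k * T" "of_int k * T" x] by simp
    ultimately show ?thesis by (metis imageI)
  qed
  then show ?thesis by (auto simp: orbit_def)
qed

text \<open>The positive periods have a least element, and over one least period the orbit is
  traversed as a simple loop.\<close>

lemma periodic_orbit_homeomorphic_sphere:
  assumes "\<not> inj (\<lambda>t. F t x)"
  shows "orbit F x homeomorphic sphere (0::plane) 1"
proof -
  have period: "F (b - a) x = x" if "F a x = F b x" for a b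
  proof -
    have "F (- a) (F b x) = F (- a) (F a x)" using that by simp
    then show ?thesis by (simp add: flow_add)
  qed
  obtain a b where "a \<noteq> b" "F a x = F b x" using assms by (auto simp: inj_def)
  then have "F \<bar>b - a\<bar> x = x"
    using period[of a b] period[of b a] by (simp add: abs_if)
  then obtain P where P: "0 < P" "F P x = x" using \<open>a \<noteq> b\<close> by (metis right_minus_eq zero_less_abs_iff)
  \<comment> \<open>Each positive period \<open>T\<close> makes the orbit reach \<open>F w x\<close>
    during \<open>{0..T}\<close>. By continuity this takes at least some time \<epsilon>, which
    bounds the periods from below.\<close>
  obtain w where w: "F w x \<noteq> x" using orbit_not_singleton by blast
  have "open ((\<lambda>t. F t x) -` (- {F w x}))" by (intro open_time_vimage) auto
  moreover have "0 \<in> (\<lambda>t. F t x) -` (- {F w x})" using w by auto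
  ultimately obtain \<epsilon> where "\<epsilon> > 0" "ball 0 \<epsilon> \<subseteq> (\<lambda>t. F t x) -` (- {F w x})"
    by (rule openE)
  then have \<epsilon>: "\<epsilon> > 0" "\<And>t. \<bar>t\<bar> < \<epsilon> \<Longrightarrow> F t x \<noteq> F w x"
    by (auto simp: subset_iff)
  have lower: "\<epsilon> \<le> T" if "0 < T" "F T x = x" for T
  proof (rule ccontr)
    assume "\<not> \<epsilon> \<le> T"
    moreover have "F w x \<in> (\<lambda>t. F t x) ` {0..T}"
      using periodic_orbit_image[OF that(2,1)] flow_mem_orbit[of w x] by blast
    then obtain t where "t \<in> {0..T}" "F w x = F t x" by blast
    ultimately show False using \<epsilon>(2)[of t] by auto
  qed
  \<comment> \<open>Cutting off at \<epsilon> and at the known period \<open>P\<close> makes the set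
    of periods compact, so a least one is attained.\<close>
  define D where "D = {\<epsilon>..P} \<inter> (\<lambda>t. F t x) -` {x}"
  have "compact D"
    unfolding D_def by (intro compact_Int_closed closed_vimage continuous_on_time) auto
  moreover have "P \<in> D" using P lower by (auto simp: D_def)
  ultimately obtain T where T: "T \<in> D" "\<And>t. t \<in> D \<Longrightarrow> T \<le> t"
    using compact_attains_inf[of D] by blast
  then have Tx: "F T x = x" "0 < T" "T \<le> P" using \<epsilon> by (auto simp: D_def)
  have least: "T \<le> t" if "0 < t" "F t x = x" for t
    using T(2)[of t] lower[OF that] that Tx(3) by (cases "t \<le> P") (auto simp: D_def)
  define g where "g = (\<lambda>s. F (T * s) x)"
  have "path g"
    unfolding path_def g_def
    by (rule continuous_on_compose2[OF continuous_on_time[of UNIV]], intro continuous_intros, simp)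
  have "simple_path g"
  proof (rule simple_pathI[OF \<open>path g\<close>])
    fix s t :: real assume st: "0 \<le> s" "s < t" "t \<le> 1" "g s = g t"
    then have "F (T * t - T * s) x = x" by (intro period) (simp add: g_def)
    then have "T \<le> T * (t - s)"
      using st Tx by (intro least) (auto simp: algebra_simps)
    then have "1 \<le> t - s" using Tx(2) by simp
    then show "s = 0 \<and> t = 1" using st by simp
  qed
  moreover have "pathfinish g = pathstart g"
    using Tx by (simp add: g_def pathfinish_def pathstart_def)
  moreover have "path_image g = orbit F x"
  proof -
    have "(*) T ` {0..1} = {0..T}" using Tx(2) by simp
    moreover have "path_image g = (\<lambda>t. F t x) ` (*) T ` {0..1}"
      by (simp add: path_image_def g_def image_image)
    ultimately show ?thesis
      using periodic_orbit_image[OF Tx(1,2)] by simp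
  qed
  ultimately show ?thesis using simple_loop_homeomorphic_sphere[of g] by simp
qed

text \<open>A minimal compact invariant set with connected complement would be a single periodic
  orbit, contradicting the Jordan curve theorem.\<close>

lemma no_periodic_orbit: "inj (\<lambda>t. F t x)"
proof (rule ccontr)
  assume per: "\<not> inj (\<lambda>t. F t x)"
  \<comment> \<open>Closedness is kept apart, since the Brouwer reduction theorem treats it
    separately from the inductive property.\<close>
  define full where "full S \<longleftrightarrow> S \<noteq> {} \<and> bounded S \<and> (\<forall>y\<in>S. orbit F y \<subseteq> S) \<and> connected (- S)" for S
  have dim: "2 \<le> DIM(plane)" by simp
  \<comment> \<open>\<open>- outside (orbit F y)\<close> is the orbit with the bounded components of
    its complement filled in.\<close>
  have fill: "closed (- outside (orbit F y))" "full (- outside (orbit F y))"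
    if "bounded (orbit F y)" for y
  proof -
    show "closed (- outside (orbit F y))"
      using open_outside[OF closed_orbit] by (simp add: closed_Compl)
    have inv: "orbit F z \<subseteq> outside (orbit F y)" if "z \<in> outside (orbit F y)" for z
    proof -
      have "z \<notin> orbit F y" using that by (auto simp: outside_def)
      then have "orbit F z \<subseteq> - orbit F y" using orbit_disjoint by blast
      then have "orbit F z \<subseteq> connected_component_set (- orbit F y) z"
        by (intro connected_component_maximal connected_orbit) auto
      moreover have "connected_component_set (- orbit F y) z \<subseteq> outside (orbit F y)"
        using that unfolding outside
        by (metis (no_types, lifting) connected_component_eq mem_Collect_eq subsetI)
      ultimately show ?thesis by blast
    qed
    have "orbit F z \<subseteq> - outside (orbit F y)" if "z \<in> - outside (orbit F y)" for z
    proof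
      fix w assume "w \<in> orbit F z"
      then have "z \<in> orbit F w" by (rule orbit_sym[THEN iffD1])
      then show "w \<in> - outside (orbit F y)" using inv[of w] that by blast
    qed
    moreover have "y \<in> - outside (orbit F y)" by (auto simp: outside_def)
    ultimately show "full (- outside (orbit F y))"
      unfolding full_def using cobounded_outside[OF that] connected_outside[OF that dim] by auto
  qed
  \<comment> \<open>The connected unbounded set \<open>- S\<close> avoids the orbit, so it lies in
    one unbounded component: the filled orbit is the least full set through
    \<open>y\<close>.\<close>
  have fill_min: "- outside (orbit F y) \<subseteq> S" if "full S" "y \<in> S" for y S
  proof -
    have "z \<in> outside (orbit F y)" if "z \<notin> S" for z
    proof -
      have "- S \<subseteq> connected_component_set (- orbit F y) z"
        using \<open>full S\<close> \<open>y \<in> S\<close> that by (intro connected_component_maximal) (auto simp: full_def)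
      moreover have "\<not> bounded (- S)"
        using \<open>full S\<close> cobounded_imp_unbounded[of "- S"] by (auto simp: full_def)
      ultimately show ?thesis
        unfolding outside using bounded_subset by blast
    qed
    then show ?thesis by blast
  qed
  have bd: "bounded (orbit F x)"
    using periodic_orbit_homeomorphic_sphere[OF per] homeomorphic_compactness compact_sphere
      compact_imp_bounded by blast
  obtain T where T: "closed T" "full T" "\<And>U. closed U \<Longrightarrow> full U \<Longrightarrow> U \<subseteq> - outside (orbit F x) \<Longrightarrow> \<not> U \<subset> T"
    "T \<subseteq> - outside (orbit F x)"
  proof (rule Brouwer_reduction_theorem_gen[of "- outside (orbit F x)" full])
    show "closed (- outside (orbit F x))" "full (- outside (orbit F x))"
      using fill[OF bd] by auto
    fix G :: "nat \<Rightarrow> plane set"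
    assume G: "\<And>n. closed (G n)" "\<And>n. full (G n)" "\<And>n. G (Suc n) \<subseteq> G n"
    have mono: "G n \<subseteq> G m" if "m \<le> n" for m n
      using lift_Suc_antimono_le[of G] G(3) that by blast
    have "\<Inter> (range G) \<noteq> {}"
      using G mono by (intro compact_nest) (auto simp: full_def compact_eq_bounded_closed)
    moreover have "bounded (\<Inter> (range G))"
      using G(2)[of 0] by (metis INF_lower UNIV_I bounded_subset full_def)
    \<comment> \<open>The complements increase and share a point outside \<open>G 0\<close>, so
      their union is connected.\<close>
    moreover have "connected (- \<Inter> (range G))"
    proof -
      have "\<Inter> (range (\<lambda>n. - G n)) \<noteq> {}"
      proof -
        have "G 0 \<noteq> UNIV" using G(2)[of 0] not_bounded_UNIV by (auto simp: full_def)
        then obtain z where "z \<notin> G 0" by blast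
        then have "z \<notin> G n" for n using mono[of 0 n] by auto
        then show ?thesis by blast
      qed
      then have "connected (\<Union> (range (\<lambda>n. - G n)))"
        using G(2) by (intro connected_Union) (auto simp: full_def)
      then show ?thesis by (simp add: Compl_INT)
    qed
    ultimately show "full (\<Inter> (range G))"
      using G(2) unfolding full_def by blast
  qed (use that in blast)
  have orb_fill: "- outside (orbit F y) = T" if "y \<in> T" for y
  proof -
    have "- outside (orbit F y) \<subseteq> T" by (rule fill_min[OF T(2) that])
    moreover have "bounded (orbit F y)"
      using T(2) that bounded_subset by (auto simp: full_def)
    ultimately show ?thesis using T(3)[OF fill] T(4) by blast
  qed
  \<comment> \<open>Each orbit in \<open>T\<close> has filling \<open>T\<close> by minimality, so it
    contains the frontier of \<open>T\<close>. One frontier point therefore puts all of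
    \<open>T\<close> on a single orbit.\<close>
  have "T \<noteq> {}" "T \<noteq> UNIV" using T(2) not_bounded_UNIV by (auto simp: full_def)
  then obtain y where y: "y \<in> frontier T" using frontier_not_empty by blast
  then have "y \<in> T" using T(1) frontier_subset_eq by blast
  have "y \<in> orbit F z" if "z \<in> T" for z
    using frontier_outside_subset[OF closed_orbit, of z] y orb_fill[OF that]
    by (metis frontier_complement subsetD)
  then have "T = orbit F y"
    using \<open>y \<in> T\<close> T(2) by (auto simp: full_def orbit_sym)
  then have "connected (- orbit F y)" "compact (orbit F y)"
    using T(1,2) by (auto simp: full_def compact_eq_bounded_closed)
  show False
  \<comment> \<open>Properness excludes a compact aperiodic orbit; a periodic one is a Jordan curve,
    whose complement is disconnected.\<close>
  proof (cases "inj (\<lambda>t. F t y)")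
    case True
    have "bounded (UNIV :: real set)"
      using aperiodic_orbit_proper[OF True \<open>compact (orbit F y)\<close>] by simp
    then show False by simp
  next
    case False
    then show False
      using Jordan_Brouwer_separation[OF periodic_orbit_homeomorphic_sphere] \<open>connected (- orbit F y)\<close>
      by simp
  qed
qed

lemmas cell_hits_convex = hitting_times_convex[OF _ no_periodic_orbit]

section \<open>Sides of an orbit\<close>

lemma orbit_not_UNIV: "\<exists>c. c \<notin> orbit F x"
proof -
  obtain e where e: "flow_chart F e" "e (0, 0) = x" using chart_at by blast
  have "e (0, 1) \<notin> orbit F x" using chart_mem_orbit[OF e(1), of 0 1 0 0] e(2) by simp
  then show ?thesis by blast
qed

lemma orbit_separates:
  obtains A B where "open A" "open B" "A \<inter> B = {}" "A \<union> B = - orbit F x"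
    "orbit F x \<subseteq> closure A" "orbit F x \<subseteq> closure B"
proof -
  obtain c where "c \<notin> range (\<lambda>t. F t x)" using orbit_not_UNIV by (auto simp: orbit_def)
  then show ?thesis
    using proper_line_separates[OF _ continuous_on_time no_periodic_orbit
        aperiodic_orbit_proper[OF no_periodic_orbit], of c x] that
    by (auto simp: orbit_def)
qed

text \<open>Being on different sides of the orbit of \<open>z\<close>, encoded by an open splitting
  of the complement instead of its components. No point of that orbit is apart from
  anything.\<close>

definition apart :: "plane \<Rightarrow> plane \<Rightarrow> plane \<Rightarrow> bool" where
  "apart z x y \<longleftrightarrow>
     (\<exists>A B. open A \<and> open B \<and> A \<inter> B = {} \<and> A \<union> B = - orbit F z \<and> x \<in> A \<and> y \<in> B)"

lemma apart_commute: "apart z x y \<Longrightarrow> apart z y x"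
proof -
  assume "apart z x y"
  then obtain A B where "open A" "open B" "A \<inter> B = {}" "A \<union> B = - orbit F z" "x \<in> A" "y \<in> B"
    unfolding apart_def by blast
  then show ?thesis
    unfolding apart_def by (intro exI[of _ B] exI[of _ A]) auto
qed

lemma apart_sym: "apart z x y \<longleftrightarrow> apart z y x"
  using apart_commute[of z x y] apart_commute[of z y x] by blast

lemma not_apart_connected:
  assumes "connected K" "K \<inter> orbit F z = {}" "x \<in> K" "y \<in> K"
  shows "\<not> apart z x y"
proof
  assume "apart z x y"
  then obtain A B where "open A" "open B" "A \<inter> B = {}" "A \<union> B = - orbit F z" "x \<in> A" "y \<in> B"
    unfolding apart_def by blast
  with connectedD[OF assms(1), of A B] assms(2-) show False by blast
qed

text \<open>A splitting between \<open>x\<close> and \<open>w\<close> has \<open>y\<close> in one of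
  its halves, as \<open>y\<close> is off the orbit of \<open>z\<close>.\<close>

lemma not_apart_trans:
  assumes "\<not> apart z x y" "\<not> apart z y w" "y \<notin> orbit F z"
  shows "\<not> apart z x w"
proof
  assume "apart z x w"
  then obtain A B where AB: "open A" "open B" "A \<inter> B = {}" "A \<union> B = - orbit F z" "x \<in> A" "w \<in> B"
    unfolding apart_def by blast
  then have "y \<in> A \<or> y \<in> B" using assms(3) by blast
  then show False using assms(1,2) AB unfolding apart_def by blast
qed

lemma not_apart_orbit: "x \<notin> orbit F z \<Longrightarrow> y \<in> orbit F x \<Longrightarrow> \<not> apart z x y"
  using not_apart_connected[OF connected_orbit orbit_disjoint, of x z x y] by simp

lemma apart_orbit_left:
  assumes "apart z x y" "x' \<in> orbit F x"
  shows "apart z x' y"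
proof -
  have "x \<notin> orbit F z" using assms(1) by (auto simp: apart_def)
  then have "x' \<notin> orbit F z" "\<not> apart z x x'"
    using assms(2) orbit_disjoint not_apart_orbit by blast+
  then show ?thesis using not_apart_trans assms(1) by blast
qed

lemma apart_orbits:
  assumes "apart z x y" "x' \<in> orbit F x" "y' \<in> orbit F y"
  shows "apart z x' y'"
proof -
  have "apart z y x'"
    using apart_orbit_left[OF assms(1,2)] by (rule apart_commute)
  then show ?thesis
    using apart_orbit_left[OF _ assms(3)] apart_commute by metis
qed

text \<open>The parts of the chart below and above level \<open>b\<close> are connected, so each
  lies on one side. The orbit is in the closure of both sides, so both meet the chart, and the two
  parts cannot share a side.\<close>

lemma apart_levels:
  assumes e: "flow_chart F e" and "b1 < b" "b < b2"
  shows "apart (e (a, b)) (e (a1, b1)) (e (a2, b2))"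
proof -
  define z where "z = e (a, b)"
  define L U where "L = e ` (UNIV \<times> {..<b})" and "U = e ` (UNIV \<times> {b<..})"
  obtain A B where AB: "open A" "open B" "A \<inter> B = {}" "A \<union> B = - orbit F z"
    "orbit F z \<subseteq> closure A" "orbit F z \<subseteq> closure B"
    using orbit_separates by blast
  have op: "open (range e)" using e by (auto simp: flow_chart_def)
  have "z \<in> range e" "z \<in> closure A" "z \<in> closure B"
    using AB(5,6) orbit_refl[of z] by (auto simp: z_def)
  then have meet: "range e \<inter> A \<noteq> {}" "range e \<inter> B \<noteq> {}"
    using open_Int_closure_eq_empty[OF op, of A] open_Int_closure_eq_empty[OF op, of B] by blast+
  have con: "connected L" "connected U"
    unfolding L_def U_def by (auto intro!: connected_chart_Times[OF e])
  have dis: "L \<inter> orbit F z = {}" "U \<inter> orbit F z = {}"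
    using chart_mem_orbit[OF e] by (auto simp: L_def U_def z_def)
  have "w \<in> L \<union> U" if w: "w \<in> range e" "w \<notin> orbit F z" for w
  proof -
    obtain c d where cd: "w = e (c, d)" using w(1) by auto
    then have "d \<noteq> b" using w(2) chart_mem_orbit[OF e] by (simp add: z_def)
    then show ?thesis using cd by (cases "d < b") (auto simp: L_def U_def)
  qed
  then have cover: "range e - orbit F z \<subseteq> L \<union> U" by blast
  have "L \<subseteq> A \<or> L \<subseteq> B"
    using connectedD[OF con(1) AB(1,2)] AB(3,4) dis(1) by blast
  moreover have "U \<subseteq> A \<or> U \<subseteq> B"
    using connectedD[OF con(2) AB(1,2)] AB(3,4) dis(2) by blast
  moreover have "\<not> (L \<subseteq> A \<and> U \<subseteq> A)" "\<not> (L \<subseteq> B \<and> U \<subseteq> B)"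
    using meet cover AB(3,4) by blast+
  ultimately have "L \<subseteq> A \<and> U \<subseteq> B \<or> L \<subseteq> B \<and> U \<subseteq> A"
    by blast
  moreover have "e (a1, b1) \<in> L" "e (a2, b2) \<in> U"
    using assms by (auto simp: L_def U_def)
  ultimately have "apart z (e (a1, b1)) (e (a2, b2)) \<or> apart z (e (a2, b2)) (e (a1, b1))"
    unfolding apart_def using AB(1-4) by blast
  then show ?thesis
    using apart_sym unfolding z_def by blast
qed

section \<open>Chains of prolongations\<close>

text \<open>Membership of \<open>q\<close> in the first prolongational limit set of
  \<open>p\<close>, stated by neighbourhoods in place of a distance; see
  \<open>mem_prolong1\<close>.\<close>

definition prolongs :: "plane \<Rightarrow> plane \<Rightarrow> bool" where
  "prolongs p q \<longleftrightarrow> (\<forall>N M T. open N \<longrightarrow> p \<in> N \<longrightarrow> open M \<longrightarrow> q \<in> M \<longrightarrow>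
     (\<exists>x \<tau>. T \<le> \<tau> \<and> x \<in> N \<and> F \<tau> x \<in> M))"

lemma prolongsE:
  assumes "prolongs p q" "open N" "p \<in> N" "open M" "q \<in> M"
  obtains x \<tau> where "T \<le> \<tau>" "x \<in> N" "F \<tau> x \<in> M"
  using assms unfolding prolongs_def by blast

text \<open>Prolongation is thus a relation between orbits; a shift along them only changes the
  bound on the time.\<close>

lemma prolongs_flow:
  assumes "prolongs p q"
  shows "prolongs (F s p) (F t q)"
  unfolding prolongs_def
proof (intro allI impI)
  fix N M T assume *: "open N" "F s p \<in> N" "open M" "F t q \<in> M"
  obtain x \<tau> where x: "T + s - t \<le> \<tau>" "x \<in> F s -` N" "F \<tau> x \<in> F t -` M"
    by (rule prolongsE[OF assms, of "F s -` N" "F t -` M" "T + s - t"])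
      (use * open_flow_vimage in auto)
  then have "F (t + \<tau> - s) (F s x) \<in> M" by (simp add: flow_add)
  then show "\<exists>x \<tau>. T \<le> \<tau> \<and> x \<in> N \<and> F \<tau> x \<in> M"
    using x by (intro exI[of _ "F s x"] exI[of _ "t + \<tau> - s"]) auto
qed

text \<open>Otherwise \<open>x\<close> prolongs to itself, and an orbit returning to a displaced
  cell after time at least 1 would, by convexity, be there at time 1.\<close>

lemma prolongs_not_orbit:
  assumes "prolongs x y"
  shows "y \<notin> orbit F x"
proof
  assume "y \<in> orbit F x"
  then obtain s where "y = F s x" by (auto simp: mem_orbit)
  then have xx: "prolongs x x" using prolongs_flow[OF assms, of 0 "- s"] by (simp add: flow_add)
  have "F 1 x \<noteq> x" using injD[OF no_periodic_orbit[of x], of 1 0] by auto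
  then obtain e r where e: "flow_chart F e" "e (0, 0) = x" and r: "0 < r"
    "\<And>w. w \<in> cell e r \<Longrightarrow> F 1 w \<notin> cell e r"
    using displaced_cell by metis
  have "x \<in> cell e r" using centre_mem_cell[OF r(1), of e] e(2) by simp
  then obtain w \<tau> where w: "1 \<le> \<tau>" "w \<in> cell e r" "F \<tau> w \<in> cell e r"
    using prolongsE[OF xx open_cell[OF e(1)] _ open_cell[OF e(1)], of r r 1] by blast
  then have "F 1 w \<in> cell e r"
    using cell_hits_convex[OF e(1), of 0 w r \<tau> 1] by simp
  then show False using r(2) w(2) by blast
qed

text \<open>A single orbit running from near \<open>x\<close> to near \<open>y\<close> would lie on
  both sides of the orbit of \<open>z\<close>.\<close>

lemma prolongs_not_apart:
  assumes "prolongs x y" "x \<notin> orbit F z" "y \<notin> orbit F z"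
  shows "\<not> apart z x y"
proof
  assume "apart z x y"
  then obtain A B where AB: "open A" "open B" "A \<inter> B = {}" "A \<union> B = - orbit F z" "x \<in> A" "y \<in> B"
    unfolding apart_def by blast
  obtain w \<tau> where w: "w \<in> A" "F \<tau> w \<in> B"
    using prolongsE[OF assms(1) AB(1,5,2,6)] by metis
  then have "apart z w (F \<tau> w)" using AB unfolding apart_def by blast
  moreover have "w \<notin> orbit F z" using w AB by blast
  ultimately show False using not_apart_orbit by simp
qed

text \<open>Orbits close to \<open>q\<close> on the common side of \<open>p\<close> and \<open>r\<close> pass near \<open>p\<close> before, and near \<open>r\<close>
  after, passing near \<open>q\<close>. The order in time is constant along a connected strip of such orbits
  because, by convexity of hitting times, it can only change inside the cell around \<open>p\<close>.\<close>

lemma prolongs_same_side: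
  assumes pq: "prolongs p q" and qr: "prolongs q r"
    and out: "p \<notin> orbit F q" "r \<notin> orbit F q" and side: "\<not> apart q p r"
  shows "prolongs p r"
  unfolding prolongs_def
proof (intro allI impI)
  fix N M T assume N: "open N" "p \<in> N" and M: "open M" "r \<in> M"
  obtain e where e: "flow_chart F e" "e (0, 0) = q" using chart_at by blast
  obtain e1 where e1: "flow_chart F e1" "e1 (0, 0) = p" using chart_at by blast
  obtain e2 where e2: "flow_chart F e2" "e2 (0, 0) = r" using chart_at by blast
  have "p \<noteq> q" using out by auto
  \<comment> \<open>These neighbourhoods will keep the cell \<open>P\<close> about \<open>p\<close>
    disjoint from the strip \<open>K\<close> near \<open>q\<close>.\<close>
  then obtain A B where AB: "open A" "open B" "p \<in> A" "q \<in> B" "A \<inter> B = {}"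
    using hausdorff[of p q] by auto
  have oq: "open (- orbit F q)" by (simp add: closed_orbit open_Compl)
  have "open (N \<inter> A \<inter> - orbit F q)" "e1 (0, 0) \<in> N \<inter> A \<inter> - orbit F q"
    using e1(2) N AB oq out by auto
  then obtain d1 where d1: "0 < d1" "cell e1 d1 \<subseteq> N \<inter> A \<inter> - orbit F q"
    using cell_subset[OF e1(1)] by blast
  have "open (M \<inter> - orbit F q)" "e2 (0, 0) \<in> M \<inter> - orbit F q"
    using e2(2) M oq out by auto
  then obtain d2 where d2: "0 < d2" "cell e2 d2 \<subseteq> M \<inter> - orbit F q"
    using cell_subset[OF e2(1)] by blast
  obtain d where d: "0 < d" "cell e d \<subseteq> B"
    using cell_subset[OF e(1) AB(2)] e(2) AB(4) by blast
  define P where "P = cell e1 d1"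
  define R where "R = cell e2 d2"
  have P: "open P" "connected P" "p \<in> P" "P \<inter> orbit F q = {}" "P \<subseteq> N" "P \<inter> cell e d = {}"
    using open_cell connected_cell centre_mem_cell[OF d1(1), of e1] e1 d1 d AB unfolding P_def by auto
  have R: "open R" "connected R" "r \<in> R" "R \<inter> orbit F q = {}" "R \<subseteq> M"
    using open_cell connected_cell centre_mem_cell[OF d2(1), of e2] e2 d2 unfolding R_def by auto
  have level: "b \<noteq> 0" if "F t x = e (a, b)" "x \<notin> orbit F q" for t x a b
  proof
    assume "b = 0"
    then have "F t x \<in> orbit F q" using chart_mem_orbit[OF e(1), of a 0 0 0] e(2) that(1) by simp
    then show False using that(2) by (metis orbit_eq orbit_flow orbit_refl)
  qed
  have stepP: "\<exists>x \<tau> a b. x \<in> P \<and> 1 \<le> \<tau> \<and> F \<tau> x = e (a, b) \<and> \<bar>a\<bar> < \<delta> \<and> \<bar>b\<bar> < \<delta> \<and> b \<noteq> 0"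
    if "0 < \<delta>" for \<delta>
  proof -
    have "q \<in> cell e \<delta>" using centre_mem_cell[OF that, of e] e(2) by simp
    then obtain x \<tau> where x: "1 \<le> \<tau>" "x \<in> P" "F \<tau> x \<in> cell e \<delta>"
      using prolongsE[OF pq P(1,3) open_cell[OF e(1)], of \<delta> 1] by blast
    then obtain a b where ab: "F \<tau> x = e (a, b)" "\<bar>a\<bar> < \<delta>" "\<bar>b\<bar> < \<delta>"
      by (auto simp: cell_def)
    moreover have "b \<noteq> 0" using level[OF ab(1)] x(2) P(4) by blast
    ultimately show ?thesis using x by blast
  qed
  have stepR: "\<exists>\<sigma> a b. F \<sigma> (e (a, b)) \<in> R \<and> T \<le> \<sigma> \<and> \<bar>a\<bar> < \<delta> \<and> \<bar>b\<bar> < \<delta> \<and> b \<noteq> 0"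
    if "0 < \<delta>" for \<delta>
  proof -
    have "q \<in> cell e \<delta>" using centre_mem_cell[OF that, of e] e(2) by simp
    then obtain z \<sigma> where z: "T \<le> \<sigma>" "z \<in> cell e \<delta>" "F \<sigma> z \<in> R"
      using prolongsE[OF qr open_cell[OF e(1)] _ R(1,3), of \<delta> T] by blast
    then obtain a b where ab: "z = e (a, b)" "\<bar>a\<bar> < \<delta>" "\<bar>b\<bar> < \<delta>"
      by (auto simp: cell_def)
    moreover have "F (- \<sigma>) (F \<sigma> z) = e (a, b)" using ab(1) by (simp add: flow_add)
    then have "b \<noteq> 0" using level z(3) R(4) by blast
    ultimately show ?thesis using z by blast
  qed
  \<comment> \<open>\<open>P\<close> and \<open>R\<close> are on the same side of the orbit of
    \<open>q\<close>, which is level 0 of the chart, so orbits from \<open>P\<close> and orbits into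
    \<open>R\<close> pass at levels of the same sign.\<close>
  have same_sign: "\<not> (b < 0 \<and> 0 < b') \<and> \<not> (b' < 0 \<and> 0 < b)"
    if x: "x \<in> P" "F \<tau> x = e (a, b)" and z: "F \<sigma> (e (a', b')) \<in> R" for x \<tau> a b \<sigma> a' b'
  proof -
    have "\<not> apart q x p" "\<not> apart q r (F \<sigma> (e (a', b')))"
      using not_apart_connected[OF P(2,4)] not_apart_connected[OF R(2,4)] P R x z by blast+
    then have "\<not> apart q x (F \<sigma> (e (a', b')))"
      using side out not_apart_trans by blast
    then have "\<not> apart q (e (a, b)) (e (a', b'))"
      using apart_orbits[of q "e (a, b)" "e (a', b')" x "F \<sigma> (e (a', b'))"] x(2)
      by (metis flow_mem_orbit orbit_sym)
    then show ?thesis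
      using apart_levels[OF e(1), of b 0 b' 0 a a'] apart_levels[OF e(1), of b' 0 b 0 a' a]
        apart_sym e(2) by metis
  qed
  \<comment> \<open>The moduli decrease from \<open>b1\<close> to \<open>b\<close> to
    \<open>b2\<close> and the signs agree, which places \<open>b\<close> between \<open>b1\<close>
    and \<open>b2\<close>. The outer two levels are reached from \<open>P\<close>, the middle one
    leads to \<open>R\<close>.\<close>
  obtain x1 \<tau>1 a1 b1 where 1: "x1 \<in> P" "1 \<le> \<tau>1" "F \<tau>1 x1 = e (a1, b1)" "\<bar>a1\<bar> < d" "\<bar>b1\<bar> < d" "b1 \<noteq> 0"
    using stepP[OF d(1)] by blast
  obtain \<sigma> a b where 0: "F \<sigma> (e (a, b)) \<in> R" "T \<le> \<sigma>" "\<bar>a\<bar> < min d \<bar>b1\<bar>" "\<bar>b\<bar> < min d \<bar>b1\<bar>" "b \<noteq> 0"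
    using stepR[of "min d \<bar>b1\<bar>"] d(1) 1(6) by auto
  obtain x2 \<tau>2 a2 b2 where 2: "x2 \<in> P" "1 \<le> \<tau>2" "F \<tau>2 x2 = e (a2, b2)" "\<bar>a2\<bar> < min d \<bar>b\<bar>" "\<bar>b2\<bar> < min d \<bar>b\<bar>" "b2 \<noteq> 0"
    using stepP[of "min d \<bar>b\<bar>"] d(1) 0(5) by auto
  have between: "b2 < b \<and> b < b1 \<or> b1 < b \<and> b < b2"
    using same_sign[OF 1(1,3) 0(1)] same_sign[OF 2(1,3) 0(1)] 0 1(5,6) 2(5,6) by (smt (verit))
  define K where "K = e ` ({-d<..<d} \<times> {min b1 b2..max b1 b2})"
  have "connected K"
    unfolding K_def by (intro connected_chart_Times[OF e(1)]) auto
  have "{-d<..<d} \<times> {min b1 b2..max b1 b2} \<subseteq> {-d<..<d} \<times> {-d<..<d}"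
    using 1(5) 2(5) by auto
  then have KP: "K \<inter> P = {}"
    using P(6) unfolding K_def cell_def by blast
  have "(a, b) \<in> {-d<..<d} \<times> {min b1 b2..max b1 b2}" "(a1, b1) \<in> {-d<..<d} \<times> {min b1 b2..max b1 b2}"
    using 0(3) 1(4) between by auto
  then have mem: "e (a, b) \<in> K" "e (a1, b1) \<in> K"
    unfolding K_def by (simp_all only: imageI)
  \<comment> \<open>At a level strictly between \<open>b1\<close> and \<open>b2\<close>, the orbit
    of \<open>z\<close> separates \<open>x1\<close> from \<open>x2\<close>, two points of the
    connected set \<open>P\<close>.\<close>
  have hit: "\<exists>t. F t z \<in> P" if zK: "z \<in> K" for z
  proof -
    obtain a' b' where z: "z = e (a', b')" "b' \<in> {min b1 b2..max b1 b2}"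
      using zK unfolding K_def by blast
    have hits: "\<exists>t. F t z \<in> P" if "x \<in> P" "F \<tau> x = e (c, b')" for x \<tau> c
    proof -
      have "z \<in> orbit F (F \<tau> x)" using chart_mem_orbit[OF e(1)] z(1) that(2) by simp
      then have "x \<in> orbit F z" using orbit_sym by simp
      then show ?thesis using that(1) by (auto simp: mem_orbit)
    qed
    have "b' = b1 \<or> b' = b2 \<or> b1 < b' \<and> b' < b2 \<or> b2 < b' \<and> b' < b1"
      using z(2) unfolding atLeastAtMost_iff min_def max_def by (smt (verit))
    then consider "b' = b1" | "b' = b2" | "b1 < b'" "b' < b2" | "b2 < b'" "b' < b1"
      by blast
    then show ?thesis
    proof cases
      case 1
      then show ?thesis using hits \<open>x1 \<in> P\<close> \<open>F \<tau>1 x1 = e (a1, b1)\<close> by blast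
    next
      case 2
      then show ?thesis using hits \<open>x2 \<in> P\<close> \<open>F \<tau>2 x2 = e (a2, b2)\<close> by blast
    next
      case 3
      then have "apart z (e (a1, b1)) (e (a2, b2))"
        using apart_levels[OF e(1)] z by blast
      then have "apart z x1 x2"
        using apart_orbits 1(3) 2(3) by (metis flow_mem_orbit orbit_sym)
      then have "P \<inter> orbit F z \<noteq> {}"
        using not_apart_connected[OF P(2)] 1(1) 2(1) by blast
      then show ?thesis by (auto simp: mem_orbit)
    next
      case 4
      then have "apart z (e (a2, b2)) (e (a1, b1))"
        using apart_levels[OF e(1)] z by blast
      then have "apart z x2 x1"
        using apart_orbits 1(3) 2(3) by (metis flow_mem_orbit orbit_sym)
      then have "P \<inter> orbit F z \<noteq> {}"
        using not_apart_connected[OF P(2)] 1(1) 2(1) by blast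
      then show ?thesis by (auto simp: mem_orbit)
    qed
  qed
  \<comment> \<open>Points that meet \<open>P\<close> in the future and in the past.\<close>
  define W where "W = (\<Union>t\<in>{0<..}. F t -` P)"
  define V where "V = (\<Union>t\<in>{..<0}. F t -` P)"
  have "open W" "open V"
    unfolding W_def V_def using open_flow_vimage[OF P(1)] by auto
  moreover have "K \<subseteq> W \<union> V"
  proof
    fix z assume "z \<in> K"
    then obtain t where t: "F t z \<in> P" using hit by blast
    then have "t \<noteq> 0" using KP \<open>z \<in> K\<close> by auto
    then show "z \<in> W \<union> V" using t unfolding W_def V_def by (cases "0 < t") auto
  qed
  moreover have "W \<inter> V \<inter> K = {}"
  proof -
    have "z \<in> P" if "F s z \<in> P" "F t z \<in> P" "s < 0" "0 < t" for s t z
      using cell_hits_convex[OF e1(1), of s z d1 t 0] that unfolding P_def by simp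
    then show ?thesis using KP unfolding W_def V_def by blast
  qed
  moreover have "e (a1, b1) \<in> V"
  proof -
    have "F (- \<tau>1) (e (a1, b1)) = x1" unfolding 1(3)[symmetric] by (simp add: flow_add)
    then show ?thesis using 1(1,2) unfolding V_def by (intro UN_I[of "- \<tau>1"]) auto
  qed
  \<comment> \<open>\<open>K\<close> is connected and lies in \<open>V\<close> as a whole. So the
    orbit at level \<open>b\<close> meets \<open>P\<close> at some \<open>t < 0\<close>, and from
    there the time to \<open>R\<close> is \<open>\<sigma> - t\<close>, more than
    \<open>T\<close>.\<close>
  ultimately have "e (a, b) \<in> V"
    using connectedD[OF \<open>connected K\<close>, of W V] mem by blast
  then obtain t where t: "t < 0" "F t (e (a, b)) \<in> P" by (auto simp: V_def)
  moreover have "F (\<sigma> - t) (F t (e (a, b))) = F \<sigma> (e (a, b))" by (simp add: flow_add)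
  ultimately show "\<exists>x \<tau>. T \<le> \<tau> \<and> x \<in> N \<and> F \<tau> x \<in> M"
    using 0(1,2) P(5) R(5)
    by (intro exI[of _ "F t (e (a, b))"] exI[of _ "\<sigma> - t"]) auto
qed

text \<open>A single jump cannot cross the orbit of \<open>z\<close>, so a chain that changes sides
  has to land on it.\<close>

lemma chain_crossing:
  assumes "(prolongs ^^ k) x y" "x \<notin> orbit F z" "y \<in> orbit F z \<or> apart z x y"
  obtains i u where "i \<le> k" "u \<in> orbit F z" "(prolongs ^^ i) x u"
proof -
  have "\<exists>i\<le>k. \<exists>u\<in>orbit F z. (prolongs ^^ i) x u"
    using assms(1,3)
  proof (induction k arbitrary: y)
    case 0
    then show ?case using not_apart_connected[of "{x}" z x x] assms(2) by auto
  next
    case (Suc k)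
    then obtain v where v: "(prolongs ^^ k) x v" "prolongs v y" by auto
    show ?case
    proof (cases "y \<in> orbit F z")
      case True
      then show ?thesis using Suc.prems by blast
    next
      case False
      then have "v \<in> orbit F z \<or> apart z x v"
        using Suc.prems not_apart_trans prolongs_not_apart[OF v(2)] by blast
      then show ?thesis using Suc.IH[OF v(1)] le_SucI by blast
    qed
  qed
  then show ?thesis using that by blast
qed

text \<open>In a shortest cycle through \<open>a\<^sub>0, a\<^sub>1, a\<^sub>2\<close> the rest of the chain avoids the orbit of \<open>a\<^sub>1\<close>, so that
  \<open>a\<^sub>0\<close> and \<open>a\<^sub>2\<close> are on the same side of it and \<open>a\<^sub>1\<close> can be skipped.\<close>

lemma chain_not_cyclic:
  assumes "(prolongs ^^ k) x y" "1 \<le> k"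
  shows "y \<notin> orbit F x"
  using assms
proof (induction k arbitrary: x y rule: less_induct)
  case (less k)
  show ?case
  proof (cases "k = 1")
    case True
    then show ?thesis using less.prems prolongs_not_orbit by auto
  next
    case False
    then obtain m where k: "k = Suc (Suc m)"
      using less.prems(2) by (metis One_nat_def not0_implies_Suc not_less_eq_eq zero_le)
    obtain a1 where a1: "prolongs x a1" "(prolongs ^^ Suc m) a1 y"
      using less.prems(1) relpowp_Suc_D2 unfolding k by metis
    obtain a2 where a2: "prolongs a1 a2" "(prolongs ^^ m) a2 y"
      using a1(2) relpowp_Suc_D2 by metis
    show ?thesis
    proof
      assume y: "y \<in> orbit F x"
      have out: "x \<notin> orbit F a1" "a2 \<notin> orbit F a1"
        using prolongs_not_orbit a1(1) a2(1) orbit_sym by blast+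
      \<comment> \<open>A point of the remaining chain on the orbit of \<open>a1\<close> would close
        a cycle of length at most \<open>Suc m < k\<close>.\<close>
      have no: "u \<notin> orbit F a1" if "i \<le> m" "(prolongs ^^ i) a2 u" for i u
        using less.IH[of "Suc i" a1 u] relpowp_Suc_I2[of prolongs, OF a2(1) that(2)] that(1) k by simp
      have "\<not> apart a1 a2 y"
        using chain_crossing[OF a2(2) out(2)] no by metis
      moreover have "y \<notin> orbit F a1" using no a2(2) by blast
      moreover have "\<not> apart a1 y x"
        using not_apart_orbit[OF out(1) y] apart_sym by blast
      ultimately have "\<not> apart a1 x a2"
        using not_apart_trans apart_sym by blast
      then have "prolongs x a2"
        using prolongs_same_side[OF a1(1) a2(1) out] by blast
      then have "(prolongs ^^ Suc m) x y"
        using a2(2) relpowp_Suc_I2 by metis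
      then show False using less.IH[of "Suc m" x y] y k by simp
    qed
  qed
qed

lemma tranclp_prolongs_not_orbit: "prolongs\<^sup>+\<^sup>+ x y \<Longrightarrow> y \<notin> orbit F x"
proof -
  assume "prolongs\<^sup>+\<^sup>+ x y"
  then obtain n where "0 < n" "(prolongs ^^ n) x y" unfolding tranclp_power by blast
  then show ?thesis using chain_not_cyclic[of n x y] by simp
qed

lemma tranclp_prolongs_flow: "prolongs\<^sup>+\<^sup>+ x y \<Longrightarrow> prolongs\<^sup>+\<^sup>+ (F s x) (F t y)"
proof (induction rule: tranclp_induct)
  case (base y)
  then show ?case using prolongs_flow by blast
next
  case (step y w)
  have "prolongs (F t y) (F t w)" using step.hyps(2) by (rule prolongs_flow)
  with step.IH show ?case by (rule tranclp.trancl_into_trancl)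
qed

section \<open>Points separated by only finitely many orbits\<close>

definition agree :: "plane \<Rightarrow> plane \<Rightarrow> bool" where
  "agree x y \<longleftrightarrow> (\<exists>C. finite C \<and> (\<forall>z. orbit F z \<inter> C = {} \<longrightarrow> \<not> apart z x y))"

lemma agree_sym:
  assumes "agree x y"
  shows "agree y x"
proof -
  obtain C where C: "finite C" "\<And>z. orbit F z \<inter> C = {} \<Longrightarrow> \<not> apart z x y"
    using assms unfolding agree_def by blast
  have "\<not> apart z y x" if "orbit F z \<inter> C = {}" for z
    using C(2)[OF that] apart_commute[of z y x] by blast
  then show ?thesis unfolding agree_def using C(1) by blast
qed

lemma agree_trans:
  assumes "agree x y" "agree y w"
  shows "agree x w"
proof -
  obtain C where C: "finite C" "\<And>z. orbit F z \<inter> C = {} \<Longrightarrow> \<not> apart z x y"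
    using assms(1) unfolding agree_def by blast
  obtain D where D: "finite D" "\<And>z. orbit F z \<inter> D = {} \<Longrightarrow> \<not> apart z y w"
    using assms(2) unfolding agree_def by blast
  \<comment> \<open>The middle point \<open>y\<close> joins the exceptional points because
    \<open>not_apart_trans\<close> asks for it to be off the orbit of \<open>z\<close>.\<close>
  have "\<not> apart z x w" if "orbit F z \<inter> (insert y (C \<union> D)) = {}" for z
    using not_apart_trans[of z x y w] C(2)[of z] D(2)[of z] that by blast
  then show ?thesis
    unfolding agree_def using C(1) D(1) by (intro exI[of _ "insert y (C \<union> D)"]) auto
qed

lemma agree_orbit:
  assumes "y \<in> orbit F x"
  shows "agree x y"
proof -
  have "\<not> apart z x y" if "orbit F z \<inter> {x} = {}" for z
    using not_apart_orbit[OF _ assms] that by simp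
  then show ?thesis unfolding agree_def by (intro exI[of _ "{x}"]) simp
qed

lemma prolongs_agree:
  assumes "prolongs x y"
  shows "agree x y"
proof -
  have "\<not> apart z x y" if "orbit F z \<inter> {x, y} = {}" for z
    using prolongs_not_apart[OF assms] that by simp
  then show ?thesis unfolding agree_def by (intro exI[of _ "{x, y}"]) simp
qed

lemma tranclp_prolongs_agree: "prolongs\<^sup>+\<^sup>+ x y \<Longrightarrow> agree x y"
proof (induction rule: tranclp_induct)
  case (base y)
  then show ?case by (rule prolongs_agree)
next
  case (step y w)
  show ?case using agree_trans[OF step.IH prolongs_agree[OF step.hyps(2)]] .
qed

text \<open>Distinct levels belong to distinct orbits, so a finite set blocks only finitely many
  levels of the interval.\<close>

lemma generic_level:
  assumes e: "flow_chart F e" and "b < b'" "finite C"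
  obtains c where "b < c" "c < b'" "orbit F (e (0, c)) \<inter> C = {}"
proof (rule ccontr)
  assume no: "\<not> thesis"
  have "\<forall>c\<in>{b<..<b'}. \<exists>y\<in>C. y \<in> orbit F (e (0, c))"
    using no that by force
  then obtain f where f: "\<And>c. c \<in> {b<..<b'} \<Longrightarrow> f c \<in> C" "\<And>c. c \<in> {b<..<b'} \<Longrightarrow> f c \<in> orbit F (e (0, c))"
    by metis
  have "inj_on f {b<..<b'}"
  proof (rule inj_onI)
    fix c c' assume *: "c \<in> {b<..<b'}" "c' \<in> {b<..<b'}" "f c = f c'"
    then have "orbit F (e (0, c)) = orbit F (e (0, c'))"
      using f(2) orbit_eq by metis
    then have "e (0, c) \<in> orbit F (e (0, c'))" using orbit_refl by blast
    then show "c = c'" using chart_mem_orbit[OF e] by blast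
  qed
  moreover have "finite (f ` {b<..<b'})"
    using f(1) \<open>finite C\<close> by (meson finite_subset image_subsetI)
  ultimately have "finite {b<..<b'}" by (rule finite_imageD[rotated])
  then show False using infinite_Ioo[OF \<open>b < b'\<close>] by simp
qed

text \<open>Every level between two given ones separates them, and one of these avoids the finite
  exceptional set.\<close>

lemma agree_same_level:
  assumes e: "flow_chart F e" and agr: "agree (e (a, b)) (e (a', b'))"
  shows "b = b'"
proof -
  have no: "\<not> s < t" if agr': "agree (e (c, s)) (e (c', t))" for c s c' t
  proof
    assume "s < t"
    obtain C where C: "finite C" "\<And>z. orbit F z \<inter> C = {} \<Longrightarrow> \<not> apart z (e (c, s)) (e (c', t))"
      using agr' unfolding agree_def by blast
    obtain l where "s < l" "l < t" "orbit F (e (0, l)) \<inter> C = {}"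
      using generic_level[OF e \<open>s < t\<close> C(1)] by blast
    then show False using apart_levels[OF e] C(2) by blast
  qed
  show ?thesis using no[OF agr] no[OF agree_sym[OF agr]] by linarith
qed

text \<open>At a generic level between \<open>s\<close> and \<open>t\<close>, the points
  \<open>x\<close> and \<open>y\<close> inherit the sides of the points they agree with. The orbit
  thus separates two points of the connected set \<open>range f\<close> and must cross it.\<close>

lemma intermediate_orbit_meets:
  assumes e: "flow_chart F e" and f: "flow_chart F f" and "s < t"
    and P: "agree (e (a, s)) x" "agree (e (a', t)) y" and xy: "x \<in> range f" "y \<in> range f"
  obtains c where "s < c" "c < t" "orbit F (e (0, c)) \<inter> range f \<noteq> {}"
proof -
  obtain C where C: "finite C" "\<And>z. orbit F z \<inter> C = {} \<Longrightarrow> \<not> apart z (e (a, s)) x"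
    using P(1) unfolding agree_def by blast
  obtain D where D: "finite D" "\<And>z. orbit F z \<inter> D = {} \<Longrightarrow> \<not> apart z (e (a', t)) y"
    using P(2) unfolding agree_def by blast
  obtain c where c: "s < c" "c < t" "orbit F (e (0, c)) \<inter> insert x (insert y (C \<union> D)) = {}"
    using generic_level[OF e \<open>s < t\<close>, of "insert x (insert y (C \<union> D))"] C(1) D(1) by auto
  let ?z = "e (0, c)"
  have ap: "apart ?z (e (a, s)) (e (a', t))" by (rule apart_levels[OF e c(1,2)])
  have n: "\<not> apart ?z (e (a, s)) x" "\<not> apart ?z y (e (a', t))" "x \<notin> orbit F ?z" "y \<notin> orbit F ?z"
    using C(2)[of ?z] D(2)[of ?z] c(3) apart_sym by blast+
  have "apart ?z x y" using not_apart_trans n ap by metis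
  moreover have "connected (range f)"
    using connected_chart_Times[OF f, of UNIV UNIV] by simp
  ultimately have "orbit F ?z \<inter> range f \<noteq> {}"
    using not_apart_connected[of "range f" ?z x y] xy by blast
  then show ?thesis using that c by blast
qed

text \<open>Orbits below and above the middle level \<open>s2\<close> both reach the chart
  \<open>f\<close>, so the orbit at \<open>s2\<close> crosses it as well. The crossing point agrees
  with \<open>y2\<close>, hence is on its level and orbit, which makes the chain to
  \<open>y2\<close> cyclic.\<close>

lemma no_three_levels:
  assumes e: "flow_chart F e" and f: "flow_chart F f" and "s1 < s2" "s2 < s3"
    and "prolongs\<^sup>+\<^sup>+ (e (a1, s1)) y1" "prolongs\<^sup>+\<^sup>+ (e (a2, s2)) y2" "prolongs\<^sup>+\<^sup>+ (e (a3, s3)) y3"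
    and "y1 \<in> range f" "y2 \<in> range f" "y3 \<in> range f"
  shows False
proof -
  note agr = tranclp_prolongs_agree[OF assms(5)] tranclp_prolongs_agree[OF assms(6)]
    tranclp_prolongs_agree[OF assms(7)]
  let ?x = "e (a2, s2)"
  obtain c where c: "c < s2" "orbit F (e (0, c)) \<inter> range f \<noteq> {}"
    using intermediate_orbit_meets[OF e f assms(3) agr(1,2) assms(8,9)] by metis
  obtain d where d: "s2 < d" "orbit F (e (0, d)) \<inter> range f \<noteq> {}"
    using intermediate_orbit_meets[OF e f assms(4) agr(2,3) assms(9,10)] by metis
  obtain v w where v: "v \<in> orbit F (e (0, c))" "v \<in> range f" and w: "w \<in> orbit F (e (0, d))" "w \<in> range f"
    using c d by blast
  have "apart ?x v w"
    using apart_orbits[OF apart_levels[OF e c(1) d(1)] v(1) w(1)] by blast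
  moreover have "connected (range f)"
    using connected_chart_Times[OF f, of UNIV UNIV] by simp
  ultimately obtain u where u: "u \<in> orbit F ?x" "u \<in> range f"
    using not_apart_connected[of "range f" ?x v w] v w by blast
  have "agree u y2"
    using agree_trans[OF agree_sym[OF agree_orbit[OF u(1)]] agr(2)] .
  moreover obtain b b' h h' where bb: "u = f (b, h)" "y2 = f (b', h')"
    using u(2) assms(9) by (metis rangeE surj_pair)
  ultimately have "h = h'" using agree_same_level[OF f] by blast
  then have "y2 \<in> orbit F u" using chart_mem_orbit[OF f] bb by simp
  then have "y2 \<in> orbit F ?x" using orbit_eq[OF u(1)] by simp
  then show False using tranclp_prolongs_not_orbit[OF assms(6)] by blast
qed

section \<open>Closedness of the chain relation\<close>

lemma frequently_off_orbit:
  assumes e: "flow_chart F e" "e (0, 0) = p" and P: "P \<longlonglongrightarrow> p"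
    and fr: "\<exists>\<^sub>F n in sequentially. P n \<notin> orbit F p"
    and ev: "eventually Q sequentially" and "0 < \<delta>"
  obtains n a b where "P n = e (a, b)" "0 < \<bar>b\<bar>" "\<bar>b\<bar> < \<delta>" "Q n"
proof -
  have cell: "\<forall>\<^sub>F n in sequentially. P n \<in> cell e \<delta>"
    using topological_tendstoD[OF P open_cell[OF e(1)], of \<delta>] centre_mem_cell[OF \<open>0 < \<delta>\<close>, of e] e(2)
    by simp
  have ex: "\<exists>\<^sub>F n in sequentially. P n \<notin> orbit F p \<and> P n \<in> cell e \<delta> \<and> Q n"
    using frequently_eventually_conj[OF fr eventually_conj[OF cell ev]]
    by (rule frequently_elim1) simp
  obtain n where n: "P n \<notin> orbit F p" "P n \<in> cell e \<delta>" "Q n"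
    using frequently_ex[OF ex] by blast
  then obtain a b where ab: "P n = e (a, b)" "\<bar>b\<bar> < \<delta>" by (auto simp: cell_def)
  have "b \<noteq> 0" using n(1) ab(1) chart_mem_orbit[OF e(1), of a b 0 0] e(2) by simp
  then show ?thesis using that[OF ab(1)] ab(2) n(3) by simp
qed

lemma tranclp_prolongs_limit:
  assumes P: "P \<longlonglongrightarrow> p" and Q: "Q \<longlonglongrightarrow> q" and PQ: "\<And>n. prolongs\<^sup>+\<^sup>+ (P n) (Q n)"
  shows "prolongs\<^sup>+\<^sup>+ p q"
proof -
  obtain e where e: "flow_chart F e" "e (0, 0) = p" using chart_at by blast
  obtain f where f: "flow_chart F f" "f (0, 0) = q" using chart_at by blast
  have "open (range f)" using f by (auto simp: flow_chart_def)
  then have evQ: "\<forall>\<^sub>F n in sequentially. Q n \<in> range f"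
    using topological_tendstoD[OF Q] f(2) by blast
  have evP: "\<forall>\<^sub>F n in sequentially. P n \<in> orbit F p"
  proof (rule ccontr)
    assume "\<not> ?thesis"
    then have fr: "\<exists>\<^sub>F n in sequentially. P n \<notin> orbit F p" by (simp add: frequently_def)
    note off = frequently_off_orbit[OF e P fr evQ]
    \<comment> \<open>Each modulus bounds the next one, so the three levels are distinct and
      \<open>no_three_levels\<close> applies in whichever order they come.\<close>
    obtain n1 a1 b1 where 1: "P n1 = e (a1, b1)" "0 < \<bar>b1\<bar>" "Q n1 \<in> range f"
      using off[OF zero_less_one] by metis
    obtain n2 a2 b2 where 2: "P n2 = e (a2, b2)" "0 < \<bar>b2\<bar>" "\<bar>b2\<bar> < \<bar>b1\<bar>" "Q n2 \<in> range f"
      using off[OF 1(2)] by metis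
    obtain n3 a3 b3 where 3: "P n3 = e (a3, b3)" "0 < \<bar>b3\<bar>" "\<bar>b3\<bar> < \<bar>b2\<bar>" "Q n3 \<in> range f"
      using off[OF 2(2)] by metis
    note tr = PQ[of n1, unfolded 1(1)] PQ[of n2, unfolded 2(1)] PQ[of n3, unfolded 3(1)]
    note no = no_three_levels[OF e(1) f(1)]
    note r = 1(3) 2(4) 3(4)
    consider "b1 < b2" "b2 < b3" | "b1 < b3" "b3 < b2" | "b2 < b1" "b1 < b3"
      | "b2 < b3" "b3 < b1" | "b3 < b1" "b1 < b2" | "b3 < b2" "b2 < b1"
      using 1(2) 2(2,3) 3(2,3) by linarith
    then show False
    proof cases
      case 1
      then show False by (rule no[OF _ _ tr(1) tr(2) tr(3) r(1) r(2) r(3)])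
    next
      case 2
      then show False by (rule no[OF _ _ tr(1) tr(3) tr(2) r(1) r(3) r(2)])
    next
      case 3
      then show False by (rule no[OF _ _ tr(2) tr(1) tr(3) r(2) r(1) r(3)])
    next
      case 4
      then show False by (rule no[OF _ _ tr(2) tr(3) tr(1) r(2) r(3) r(1)])
    next
      case 5
      then show False by (rule no[OF _ _ tr(3) tr(1) tr(2) r(3) r(1) r(2)])
    next
      case 6
      then show False by (rule no[OF _ _ tr(3) tr(2) tr(1) r(3) r(2) r(1)])
    qed
  qed
  have "\<forall>\<^sub>F n in sequentially. Q n \<in> orbit F q"
  proof (rule ccontr)
    assume "\<not> ?thesis"
    then have fr: "\<exists>\<^sub>F n in sequentially. Q n \<notin> orbit F q" by (simp add: frequently_def)
    note off = frequently_off_orbit[OF f Q fr evP]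
    obtain n1 a1 b1 where 1: "Q n1 = f (a1, b1)" "0 < \<bar>b1\<bar>" "P n1 \<in> orbit F p"
      using off[OF zero_less_one] by metis
    obtain n2 a2 b2 where 2: "Q n2 = f (a2, b2)" "\<bar>b2\<bar> < \<bar>b1\<bar>" "P n2 \<in> orbit F p"
      using off[OF 1(2)] by metis
    \<comment> \<open>The starting points share the orbit of \<open>p\<close>, so the endpoints
      agree and cannot be at two levels of \<open>f\<close>; here two indices are enough.\<close>
    have "P n2 \<in> orbit F (P n1)" using 1(3) 2(3) orbit_eq by simp
    then have "agree (Q n1) (Q n2)"
      using agree_trans[OF agree_sym[OF tranclp_prolongs_agree[OF PQ[of n1]]]
          agree_trans[OF agree_orbit tranclp_prolongs_agree[OF PQ[of n2]]]] by blast
    then have "b1 = b2" using agree_same_level[OF f(1)] 1(1) 2(1) by simp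
    then show False using 2(2) by simp
  qed
  with evP have "\<forall>\<^sub>F n in sequentially. P n \<in> orbit F p \<and> Q n \<in> orbit F q"
    by (rule eventually_conj)
  \<comment> \<open>The relation depends only on the orbits, so one such index gives the chain from
    \<open>p\<close> to \<open>q\<close>.\<close>
  then obtain n where n: "P n \<in> orbit F p" "Q n \<in> orbit F q"
    using eventually_happens' sequentially_bot by blast
  then obtain s t where "p = F s (P n)" "q = F t (Q n)"
    using orbit_sym mem_orbit by metis
  then show ?thesis using tranclp_prolongs_flow[OF PQ] by simp
qed

end

section \<open>Prolongational limit sets of a regular flow\<close>

lemma regular_flow_planar_flow:
  assumes "regular_flow F"
  shows "planar_flow F"
proof
  have "flow F" using assms by (simp add: regular_flow_def)
  then show "continuous_on UNIV (\<lambda>(t, x). F t x)" "F t (F s x) = F (t + s) x" "F 0 x = x" for s t x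
    by (simp_all add: flow_def)
  show "\<exists>e. flow_chart F e \<and> e (0, 0) = p" for p
    using regular_flow_chart[OF assms] by metis
qed

text \<open>In this form the union of all iterates becomes a transitive closure.\<close>

lemma mem_iterate: "q \<in> iterate R k p \<longleftrightarrow> ((\<lambda>x y. y \<in> R x) ^^ k) p q"
proof (induction k arbitrary: q)
  case 0
  then show ?case by (auto simp: iterate_def)
next
  case (Suc k)
  have "q \<in> iterate R (Suc k) p \<longleftrightarrow> (\<exists>x\<in>iterate R k p. q \<in> R x)"
    by (simp add: iterate_def)
  then show ?case using Suc by auto
qed

context planar_flow
begin

lemma mem_prolong1:
  assumes "compatible_distance d"
  shows "q \<in> prolong1 d F p \<longleftrightarrow> prolongs p q"
proof -
  interpret M: Metric_space UNIV d
    using assms by (simp add: compatible_distance_def)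
  have "M.mtopology = euclidean"
    using assms by (simp add: compatible_distance_def)
  then have top: "openin M.mtopology U \<longleftrightarrow> open U" for U
    by (simp only: open_openin)
  have ball: "open {y. d x y < r}" for x r
    using M.openin_mball[of x r] unfolding top M.mball_def by simp
  have nbhd: "\<exists>r>0. \<forall>y. d x y < r \<longrightarrow> y \<in> U" if "open U" "x \<in> U" for U x
    using that unfolding top[symmetric] M.openin_mtopology by (auto simp: subset_iff)
  show ?thesis
  proof
    assume q: "q \<in> prolong1 d F p"
    show "prolongs p q"
      unfolding prolongs_def
    proof (intro allI impI)
      fix N M and T :: real assume "open N" "p \<in> N" "open M" "q \<in> M"
      then obtain r s where r: "0 < r" "\<And>y. d p y < r \<Longrightarrow> y \<in> N" and s: "0 < s" "\<And>y. d q y < s \<Longrightarrow> y \<in> M"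
        using nbhd by metis
      \<comment> \<open>\<open>prolong1\<close> has one \<epsilon> for both points and asks for a
        positive time bound.\<close>
      have "0 < min r s" "0 < max T 1" using r(1) s(1) by auto
      then obtain x \<tau> where "max T 1 \<le> \<tau>" "d p x < min r s" "d q (F \<tau> x) < min r s"
        using q unfolding prolong1_def mem_Collect_eq by meson
      then show "\<exists>x \<tau>. T \<le> \<tau> \<and> x \<in> N \<and> F \<tau> x \<in> M"
        using r(2) s(2) by (intro exI[of _ x] exI[of _ \<tau>]) auto
    qed
  next
    assume pq: "prolongs p q"
    show "q \<in> prolong1 d F p"
      unfolding prolong1_def mem_Collect_eq
    proof (intro allI impI)
      fix \<epsilon> T :: real assume "0 < \<epsilon>" "0 < T"
      then have "p \<in> {y. d p y < \<epsilon>}" "q \<in> {y. d q y < \<epsilon>}" by simp_all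
      then obtain x \<tau> where "T \<le> \<tau>" "x \<in> {y. d p y < \<epsilon>}" "F \<tau> x \<in> {y. d q y < \<epsilon>}"
        using prolongsE[OF pq ball _ ball] by metis
      then show "\<exists>x \<tau>. T \<le> \<tau> \<and> d p x < \<epsilon> \<and> d q (F \<tau> x) < \<epsilon>" by auto
    qed
  qed
qed

lemma Union_iterate_prolong1:
  assumes "compatible_distance d"
  shows "(\<Union>k\<in>{1..}. iterate (prolong1 d F) k p) = {q. prolongs\<^sup>+\<^sup>+ p q}"
proof -
  have "(\<lambda>x y. y \<in> prolong1 d F x) = prolongs"
    using mem_prolong1[OF assms] by (intro ext) simp
  then show ?thesis
    by (auto simp: mem_iterate tranclp_power Suc_le_eq)
qed

text \<open>A chain of chains is a chain, and limits of chains are chains by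
  \<open>tranclp_prolongs_limit\<close>.\<close>

lemma prolong_step_subset_reach:
  assumes "\<And>R x. R \<in> S \<Longrightarrow> R x \<subseteq> {y. prolongs\<^sup>+\<^sup>+ x y}"
  shows "prolong_step S p \<subseteq> {q. prolongs\<^sup>+\<^sup>+ p q}"
proof
  fix q assume "q \<in> prolong_step S p"
  then obtain P Q k R where PQ: "P \<longlonglongrightarrow> p" "Q \<longlonglongrightarrow> q"
    and *: "\<And>n. k n \<ge> 1 \<and> R n \<in> S \<and> Q n \<in> iterate (R n) (k n) (P n)"
    unfolding prolong_step_def by blast
  have "prolongs\<^sup>+\<^sup>+ (P n) (Q n)" for n
  proof -
    \<comment> \<open>The maps \<open>R n\<close>, which may come from different ordinals, are all
      enlarged to the same reachability map.\<close>
    have "Q n \<in> iterate (\<lambda>x. {y. prolongs\<^sup>+\<^sup>+ x y}) (k n) (P n)"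
      using * iterate_mono[of "R n" "\<lambda>x. {y. prolongs\<^sup>+\<^sup>+ x y}"] assms[of "R n"] by blast
    then have "(prolongs\<^sup>+\<^sup>+ ^^ k n) (P n) (Q n)" by (simp add: mem_iterate)
    moreover have "0 < k n" using *[of n] by simp
    ultimately have "prolongs\<^sup>+\<^sup>+\<^sup>+\<^sup>+ (P n) (Q n)"
      unfolding tranclp_power[of "prolongs\<^sup>+\<^sup>+"] by blast
    then show ?thesis
    proof (induction rule: tranclp_induct)
      case (step y z)
      show ?case using step.IH step.hyps(2) by (rule tranclp_trans)
    qed
  qed
  then show "q \<in> {q. prolongs\<^sup>+\<^sup>+ p q}"
    using tranclp_prolongs_limit[OF PQ] by simp
qed

text \<open>Transfinite induction: successor and limit stages are both instances of
  \<open>prolong_step\<close>, which does not lead out of the transitive closure.\<close>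

lemma prolong_subset_reach:
  assumes "compatible_distance d"
  shows "prolong d F (\<alpha> :: ordinal) p \<subseteq> {q. prolongs\<^sup>+\<^sup>+ p q}"
proof (induction \<alpha> arbitrary: p rule: less_induct)
  case (less \<alpha>)
  consider "\<alpha> = ord_zero" | "\<alpha> = ord_suc ord_zero"
    | \<gamma> where "ord_zero < \<gamma>" "\<gamma> < \<alpha>" "\<alpha> = ord_suc \<gamma>"
    | "\<alpha> \<noteq> ord_zero" "\<And>\<beta>. \<beta> < \<alpha> \<Longrightarrow> \<alpha> \<noteq> ord_suc \<beta>"
    by (metis ord_zero_le order.strict_iff_order)
  then show ?case
  proof cases
    case 1
    then show ?thesis by (simp add: prolong_zero)
  next
    case 2
    then have "prolong d F \<alpha> = prolong1 d F"
      using ordinal_less_suc[of ord_zero] by (simp add: prolong_one)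
    then show ?thesis using mem_prolong1[OF assms] by auto
  next
    case 3
    then have "prolong d F \<alpha> p = prolong_step {prolong d F \<gamma>} p"
      by (simp add: prolong_suc)
    also have "\<dots> \<subseteq> {q. prolongs\<^sup>+\<^sup>+ p q}"
      using less[OF 3(2)] by (intro prolong_step_subset_reach) auto
    finally show ?thesis .
  next
    case 4
    then have "prolong d F \<alpha> p = prolong_step (prolong d F ` {\<beta>. ord_suc ord_zero \<le> \<beta> \<and> \<beta> < \<alpha>}) p"
      by (subst prolong_limit) auto
    also have "\<dots> \<subseteq> {q. prolongs\<^sup>+\<^sup>+ p q}"
      using less by (intro prolong_step_subset_reach) auto
    finally show ?thesis .
  qed
qed

end

theorem theorem1:
  fixes F :: "real \<Rightarrow> plane \<Rightarrow> plane" and d :: "plane \<Rightarrow> plane \<Rightarrow> real"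
  assumes "compatible_distance d" and "regular_flow F"
  shows "(\<forall>p. prolong d F (ord_nat 2 :: ordinal) p
              = (\<Union>k\<in>{1..}. iterate (prolong d F (ord_nat 1 :: ordinal)) k p)
            \<and> prolong_star d F p = prolong d F (ord_nat 2 :: ordinal) p)
         \<and> flow_rank d F \<le> ord_nat 2"
proof -
  interpret planar_flow F
    using assms(2) by (rule regular_flow_planar_flow)
  let ?o = "ord_suc ord_zero :: ordinal"
  have nat: "ord_nat 1 = ?o" "ord_nat 2 = ord_suc ?o"
    by (simp_all add: ord_nat_def numeral_2_eq_2)
  have one: "prolong d F ?o = prolong1 d F"
    using ordinal_less_suc[of ord_zero] by (intro prolong_one) auto
  have two: "prolong d F (ord_suc ?o) = prolong_step {prolong1 d F}"
    using prolong_suc[OF ordinal_less_suc ordinal_less_suc] one by metis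
  have reach: "prolong d F (ord_nat 2 :: ordinal) p = {q. prolongs\<^sup>+\<^sup>+ p q}" for p
  proof
    show "prolong d F (ord_nat 2 :: ordinal) p \<subseteq> {q. prolongs\<^sup>+\<^sup>+ p q}"
      by (rule prolong_subset_reach[OF assms(1)])
    \<comment> \<open>Constant sequences show that every finite iterate of the first stage is
      contained in the second.\<close>
    have "q \<in> prolong_step {prolong1 d F} p" if "k \<in> {1..}" "q \<in> iterate (prolong1 d F) k p" for k q
      unfolding prolong_step_def mem_Collect_eq using that
      by (intro exI[of _ "\<lambda>_. p"] exI[of _ "\<lambda>_. q"] exI[of _ "\<lambda>_. k"] exI[of _ "\<lambda>_. prolong1 d F"]) simp
    then show "{q. prolongs\<^sup>+\<^sup>+ p q} \<subseteq> prolong d F (ord_nat 2 :: ordinal) p"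
      unfolding nat two Union_iterate_prolong1[OF assms(1), symmetric] by blast
  qed
  have star: "prolong_star d F p = prolong d F (ord_nat 2 :: ordinal) p" for p
  proof
    show "prolong_star d F p \<subseteq> prolong d F (ord_nat 2 :: ordinal) p"
      unfolding prolong_star_def reach using prolong_subset_reach[OF assms(1)] by blast
    have "(ord_nat 1 :: ordinal) \<le> ord_nat 2"
      unfolding nat using ordinal_less_suc[of ?o] by simp
    then show "prolong d F (ord_nat 2 :: ordinal) p \<subseteq> prolong_star d F p"
      unfolding prolong_star_def by blast
  qed
  have "flow_rank d F \<le> ord_nat 2"
    unfolding flow_rank_def using star by (intro Least_le) simp
  moreover have "prolong d F (ord_nat 2 :: ordinal) p
      = (\<Union>k\<in>{1..}. iterate (prolong d F (ord_nat 1 :: ordinal)) k p)" for p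
    unfolding reach nat(1) one Union_iterate_prolong1[OF assms(1)] ..
  ultimately show ?thesis using star by blast
qed

end
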